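(* Let $A$ be a unital C*-algebra of real rank zero that admits no characters. Then $\xi(A)\leq3$ and $A=[A,A]_1+[A,A]_1\cdot[A,A]_1$, i.e. every element of $A$ is of the form $[b,c]+[d,e][f,g]$ with $b,c,d,e,f,g\in A$.
   Context: $[x,y]=xy-yx$; $[A,A]_1$ is the set of commutators; $X\cdot Y$ is the set of products and $X+Y$ the set of sums. A unital C*-algebra has real rank zero if self-adjoint elements with finite spectrum are dense among self-adjoint elements. A character is a nonzero homomorphism $A\to\mathbb{C}$. For a unital ring $T$ generated by its commutators, $\xi(T)$ is the minimal $N$ such that every element of $T$ is a sum of $N$ elements of the form $[b,c][d,e]$ with $b,c,d,e\in T$. *)

theory Defs
  imports "HOL-Analysis.Analysis"
begin

text \<open>A unital C*-algebra is modelled on a type 'a that is a real Banach algebra with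
  unit of norm 1 (class banach + real_normed_algebra_1), together with a complex scalar
  multiplication sc (extending the real one) and an involution st satisfying the C*-identity.\<close>

definition cstar_algebra :: "(complex \<Rightarrow> 'a::{banach,real_normed_algebra_1} \<Rightarrow> 'a) \<Rightarrow> ('a \<Rightarrow> 'a) \<Rightarrow> bool" where
  "cstar_algebra sc st \<longleftrightarrow>
     (\<forall>r a. sc (complex_of_real r) a = scaleR r a) \<and>
     (\<forall>c d a. sc (c + d) a = sc c a + sc d a) \<and>
     (\<forall>c a b. sc c (a + b) = sc c a + sc c b) \<and>
     (\<forall>c d a. sc (c * d) a = sc c (sc d a)) \<and>
     (\<forall>c a b. sc c (a * b) = sc c a * b) \<and>
     (\<forall>c a b. sc c (a * b) = a * sc c b) \<and>
     (\<forall>c a. norm (sc c a) = cmod c * norm a) \<and>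
     (\<forall>a b. st (a + b) = st a + st b) \<and>
     (\<forall>c a. st (sc c a) = sc (cnj c) (st a)) \<and>
     (\<forall>a b. st (a * b) = st b * st a) \<and>
     (\<forall>a. st (st a) = a) \<and>
     (\<forall>a. norm (st a * a) = (norm a)\<^sup>2)"

definition invertible_el :: "'a::ring_1 \<Rightarrow> bool" where
  "invertible_el a \<longleftrightarrow> (\<exists>b. a * b = 1 \<and> b * a = 1)"

definition spec :: "(complex \<Rightarrow> 'a::ring_1 \<Rightarrow> 'a) \<Rightarrow> 'a \<Rightarrow> complex set" where
  "spec sc a = {z. \<not> invertible_el (a - sc z 1)}"

definition real_rank_zero :: "(complex \<Rightarrow> 'a::{banach,real_normed_algebra_1} \<Rightarrow> 'a) \<Rightarrow> ('a \<Rightarrow> 'a) \<Rightarrow> bool" where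
  "real_rank_zero sc st \<longleftrightarrow>
     (\<forall>a. st a = a \<longrightarrow> a \<in> closure {b. st b = b \<and> finite (spec sc b)})"

definition character :: "(complex \<Rightarrow> 'a::ring_1 \<Rightarrow> 'a) \<Rightarrow> ('a \<Rightarrow> complex) \<Rightarrow> bool" where
  "character sc h \<longleftrightarrow>
     (\<forall>a b. h (a + b) = h a + h b) \<and>
     (\<forall>c a. h (sc c a) = c * h a) \<and>
     (\<forall>a b. h (a * b) = h a * h b) \<and>
     (\<exists>a. h a \<noteq> 0)"

definition commutator :: "'a::ring \<Rightarrow> 'a \<Rightarrow> 'a" where
  "commutator x y = x * y - y * x"

definition commutators :: "'a::ring set" where
  "commutators = {commutator b c | b c. True}"

definition set_prod :: "'a::times set \<Rightarrow> 'a set \<Rightarrow> 'a set" where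
  "set_prod X Y = {x * y | x y. x \<in> X \<and> y \<in> Y}"

definition set_sum :: "'a::plus set \<Rightarrow> 'a set \<Rightarrow> 'a set" where
  "set_sum X Y = {x + y | x y. x \<in> X \<and> y \<in> Y}"

text \<open>xi(T) \<le> N: every element is a sum of N' \<le> N products [b,c][d,e].
  (This also entails that T is generated by its commutators.)\<close>
definition xi_le :: "nat \<Rightarrow> 'a::ring_1 itself \<Rightarrow> bool" where
  "xi_le N _ \<longleftrightarrow> (\<exists>M\<le>N. \<forall>x::'a. \<exists>b c d e :: nat \<Rightarrow> 'a.
      x = (\<Sum>i<M. commutator (b i) (c i) * commutator (d i) (e i)))"

end

theory Submission
  imports Defs "HOL-Computational_Algebra.Fundamental_Theorem_Algebra"
begin

text \<open>A unital C*-algebra of real rank zero is an exchange ring: for every \<open>a\<close> there is an idempotent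
  \<open>e \<in> aA\<close> with \<open>1 - e \<in> (1 - a)A\<close>. If it has no characters, then it is generated as an ideal by the
  corners \<open>gA(1 - g)\<close>, \<open>g\<close> idempotent: otherwise all commutators lie in a maximal ideal, and the
  finite spectrum approximations give every self-adjoint element a scalar value modulo that ideal.

  In an exchange ring in which these corners generate, one can write \<open>1 = y + y' + c\<close> with orthogonal
  idempotents, \<open>y\<close> equivalent to \<open>y'\<close> and \<open>c\<close> equivalent to a subidempotent of \<open>y\<close>. With respect to this
  decomposition every element with zero diagonal is a commutator \<open>[y - y', w]\<close>, every diagonal is the
  diagonal of a product of two elements with zero diagonal, and some invertible diagonal element
  \<open>d\<close> is a commutator. Hence \<open>x = z + uv\<close> with \<open>u, v, z\<close> of zero diagonal, and \<open>z = d (d\<inverse> z)\<close>; in fact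
  two products of commutators suffice.\<close>

section \<open>Idempotents in exchange rings\<close>

text \<open>Membership of \<open>1\<close> in the ideal of the corners is a finite sum of
  uncontrolled length, while the target is a fixed 3 x 3 block shape. The summands are therefore
  absorbed one at a time: exchange, applied to an idempotent written as a sum of two elements, cuts
  it into a part factoring through the first and a part factoring through the second, so the
  remainder needs one summand less.

  The shape itself comes from the products. A diagonal block of \<open>x\<close> can be produced by
  two factors of zero diagonal if there is a path out of the block and back: \<open>y\<close> and
  \<open>y'\<close> serve each other, and \<open>c\<close> is served by \<open>y\<close>.

  On the analytic side, real rank zero supplies only approximants of finite spectrum, the spectrum
  being defined by invertibility. Real eigenvalues, norms and positivity must all be extracted from
  finite sums of projections and carried through limits. The crux is positivity of
  \<open>b * st b\<close>: it makes \<open>a * st a + (1 - a) * st (1 - a)\<close> bounded below, so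
  that an approximate spectral splitting can be corrected by an invertible element.\<close>

definition idem :: "'a::ring_1 \<Rightarrow> bool" where
  "idem e \<longleftrightarrow> e * e = e"

definition orth :: "'a::ring_1 \<Rightarrow> 'a \<Rightarrow> bool" where
  "orth e f \<longleftrightarrow> e * f = 0 \<and> f * e = 0"

definition below :: "'a::ring_1 \<Rightarrow> 'a \<Rightarrow> bool" where
  "below e f \<longleftrightarrow> f * e = e \<and> e * f = e"

text \<open>Murray-von Neumann comparison without the involution. The image of \<open>e\<close>
  inside \<open>f\<close> is not named; it is \<open>b * a\<close>, recovered in
  \<open>subequivE\<close>.\<close>

definition subequiv :: "'a::ring_1 \<Rightarrow> 'a \<Rightarrow> bool" where
  "subequiv e f \<longleftrightarrow> (\<exists>a b. a * b = e \<and> e * a = a \<and> a * f = a \<and> f * b = b \<and> b * e = b)"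

definition equivalent :: "'a::ring_1 \<Rightarrow> 'a \<Rightarrow> bool" where
  "equivalent e f \<longleftrightarrow>
     (\<exists>a b. a * b = e \<and> b * a = f \<and> e * a = a \<and> a * f = a \<and> f * b = b \<and> b * e = b)"

text \<open>Once \<open>mult.assoc\<close> nests products to the right, a relation
  \<open>a * b = c\<close> inside a longer product only matches in this form.\<close>

lemma mult_eq_left: "a * b = (c::'a::ring_1) \<Longrightarrow> a * (b * x) = c * x"
  by (simp add: mult.assoc[symmetric])

lemma mult_zero_units: "x * e = x \<Longrightarrow> f * z = z \<Longrightarrow> e * f = 0 \<Longrightarrow> x * z = (0::'a::ring_1)"
  by (metis mult.assoc mult_zero_left mult_zero_right)

lemma orth_sym: "orth e f \<Longrightarrow> orth f e"
  by (simp add: orth_def)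

lemma orth_below: "orth e f \<Longrightarrow> below e' e \<Longrightarrow> orth e' f"
  unfolding orth_def below_def by (metis mult.assoc mult_zero_left mult_zero_right)

lemma orth_below2: "orth e f \<Longrightarrow> below e' e \<Longrightarrow> below f' f \<Longrightarrow> orth e' f'"
  by (meson orth_below orth_sym)

lemma orth_add: "orth e f \<Longrightarrow> orth e' f \<Longrightarrow> orth (e + e') f"
  by (simp add: orth_def distrib_left distrib_right)

lemma idem_add: "idem e \<Longrightarrow> idem f \<Longrightarrow> orth e f \<Longrightarrow> idem (e + f)"
  by (simp add: idem_def orth_def distrib_left distrib_right)

lemma below_trans: "below e f \<Longrightarrow> below f g \<Longrightarrow> below e g"
  unfolding below_def by (metis mult.assoc)

lemma below_add: "below e g \<Longrightarrow> below f g \<Longrightarrow> below (e + f) g"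
  by (simp add: below_def distrib_left distrib_right)

lemma below_add_orth: "idem e \<Longrightarrow> orth e f \<Longrightarrow> below e (e + f)"
  by (simp add: below_def idem_def orth_def distrib_left distrib_right)

lemma below_diff: "idem e \<Longrightarrow> idem f \<Longrightarrow> below e f \<Longrightarrow> idem (f - e) \<and> orth e (f - e) \<and> below (f - e) f"
  by (simp add: below_def idem_def orth_def algebra_simps)

lemma equivalent_sym: "equivalent e f \<Longrightarrow> equivalent f e"
  unfolding equivalent_def by blast

lemma equivalent_trans:
  assumes "equivalent e f" and "equivalent f g"
  shows "equivalent e g"
proof -
  obtain a b where ab: "a * b = e" "b * a = f" "e * a = a" "a * f = a" "f * b = b" "b * e = b"
    using assms(1) by (auto simp: equivalent_def)
  obtain c d where cd: "c * d = f" "d * c = g" "f * c = c" "c * g = c" "g * d = d" "d * f = d"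
    using assms(2) by (auto simp: equivalent_def)
  note [simp] = ab cd ab[THEN mult_eq_left] cd[THEN mult_eq_left]
  show ?thesis
    unfolding equivalent_def
    by (rule exI[of _ "a * c"], rule exI[of _ "d * b"]) (simp add: mult.assoc)
qed

lemma equivalent_add:
  assumes "equivalent e f" "equivalent e' f'" "orth e e'" "orth f f'"
  shows "equivalent (e + e') (f + f')"
proof -
  obtain a b where ab: "a * b = e" "b * a = f" "e * a = a" "a * f = a" "f * b = b" "b * e = b"
    using assms(1) by (auto simp: equivalent_def)
  obtain c d where cd: "c * d = e'" "d * c = f'" "e' * c = c" "c * f' = c" "f' * d = d" "d * e' = d"
    using assms(2) by (auto simp: equivalent_def)
  have o: "e * e' = 0" "e' * e = 0" "f * f' = 0" "f' * f = 0"
    using assms(3,4) by (auto simp: orth_def)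
  have u: "e * e = e" "e' * e' = e'" "f * f = f" "f' * f' = f'"
    by (metis ab cd mult.assoc)+
  have z: "a * d = 0" "c * b = 0" "b * c = 0" "d * a = 0"
    "e * c = 0" "e' * a = 0" "a * f' = 0" "c * f = 0" "f * d = 0" "f' * b = 0" "b * e' = 0" "d * e = 0"
    by (blast intro: mult_zero_units o ab cd u)+
  show ?thesis
    unfolding equivalent_def
    by (rule exI[of _ "a + c"], rule exI[of _ "b + d"])
      (simp add: distrib_left distrib_right ab cd z)
qed

lemma equivalent_imp_subequiv: "equivalent e f \<Longrightarrow> subequiv e f"
  unfolding equivalent_def subequiv_def by blast

lemma subequiv_mono: "subequiv e f \<Longrightarrow> below f g \<Longrightarrow> subequiv e g"
  unfolding subequiv_def below_def by (metis mult.assoc)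

lemma subequivE:
  assumes "subequiv e f" "idem e"
  obtains f' where "equivalent e f'" "idem f'" "below f' f"
proof -
  obtain a b where ab: "a * b = e" "e * a = a" "a * f = a" "f * b = b" "b * e = b"
    using assms(1) by (auto simp: subequiv_def)
  have ee: "e * e = e" using assms(2) by (simp add: idem_def)
  note [simp] = ab ee ab[THEN mult_eq_left] ee[THEN mult_eq_left]
  have "equivalent e (b * a)"
    unfolding equivalent_def
    by (rule exI[of _ a], rule exI[of _ b]) (simp add: mult.assoc)
  moreover have "idem (b * a)" "below (b * a) f"
    by (simp_all add: idem_def below_def mult.assoc)
  ultimately show ?thesis using that by blast
qed

lemma subequiv_add:
  assumes "subequiv e f" "subequiv e' f'" "idem e" "idem e'" "orth e e'" "orth f f'" "idem f" "idem f'"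
  shows "subequiv (e + e') (f + f')"
proof -
  obtain g where g: "equivalent e g" "idem g" "below g f" using assms by (meson subequivE)
  obtain g' where g': "equivalent e' g'" "idem g'" "below g' f'" using assms by (meson subequivE)
  have "orth g g'" using g g' assms by (meson orth_below2)
  hence "equivalent (e + e') (g + g')" using g g' assms by (simp add: equivalent_add)
  moreover have "below (g + g') (f + f')"
    using g g' assms by (metis add.commute below_add below_add_orth below_trans orth_sym)
  ultimately show ?thesis
    by (meson equivalent_imp_subequiv subequiv_mono)
qed

text \<open>The compressions \<open>e * x * f\<close> and \<open>f * y * e\<close> are the
  witnesses, so one occurrence of \<open>f\<close> inside a product equal to \<open>e\<close> is
  enough.\<close>

lemma subequiv_factor:
  assumes "idem e" "idem f" "e = e * x * f * y * e"
  shows "subequiv e f"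
  unfolding subequiv_def
proof (intro exI conjI)
  show "(e * x * f) * (f * y * e) = e" "e * (e * x * f) = e * x * f" "e * x * f * f = e * x * f"
     "f * (f * y * e) = f * y * e" "f * y * e * e = f * y * e"
    using assms unfolding idem_def by (metis mult.assoc)+
qed

section \<open>The exchange property and generated ideals\<close>

definition exchange :: "'a::ring_1 itself \<Rightarrow> bool" where
  "exchange _ \<longleftrightarrow> (\<forall>a::'a. \<exists>e u v. idem e \<and> e = a * u \<and> 1 - e = (1 - a) * v)"

text \<open>From \<open>e = a * u\<close> and \<open>q * a = a\<close> follows
  \<open>q * e = e\<close>; hence \<open>e * q\<close> is an idempotent of the corner of
  \<open>q\<close>, and compressing \<open>1 - e\<close> by \<open>q\<close> gives a right multiple
  of \<open>q - a\<close>.\<close>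

lemma exchange_corner:
  fixes q a :: "'a::ring_1"
  assumes "exchange TYPE('a)" and q: "idem q" and a: "q * a = a" "a * q = a"
  obtains e u v where "idem e" "below e q" "e = a * u" "q - e = (q - a) * v"
proof -
  obtain e u v where e: "idem e" "e = a * u" "1 - e = (1 - a) * v"
    using assms(1) unfolding exchange_def by metis
  have qe: "q * e = e" using e(2) a(1) by (simp add: mult.assoc[symmetric])
  have qq: "q * q = q" using q by (simp add: idem_def)
  have ee: "e * e = e" using e by (simp add: idem_def)
  note s = qe qq ee qe[THEN mult_eq_left] qq[THEN mult_eq_left] ee[THEN mult_eq_left]
  have 1: "idem (e * q)" "below (e * q) q"
    by (simp_all add: idem_def below_def mult.assoc s)
  have 2: "e * q = a * (u * q)" using e(2) by (simp add: mult.assoc)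
  have "q - e * q = q * (1 - e) * q" by (simp add: algebra_simps s)
  also have "\<dots> = q * (1 - a) * v * q" by (simp add: e(3) mult.assoc)
  also have "\<dots> = (q - a) * (v * q)" by (simp add: algebra_simps a a[THEN mult_eq_left])
  finally show ?thesis using that 1 2 by blast
qed

text \<open>Within the corner of \<open>q\<close>, the complement of \<open>q * s * q\<close> is
  \<open>q * t * q\<close>. Together with \<open>subequiv_factor\<close> this turns additive
  decompositions into subequivalences.\<close>

lemma exchange_split:
  fixes q s t :: "'a::ring_1"
  assumes x: "exchange TYPE('a)" and q: "idem q" and st: "q = s + t"
  obtains e u v where "idem e" "below e q" "e = e * s * u * e" "q - e = (q - e) * t * v * (q - e)"
proof -
  have qq: "q * q = q" using q by (simp add: idem_def)
  obtain e u v where e: "idem e" "below e q" "e = q * s * q * u" "q - e = (q - q * s * q) * v"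
    using exchange_corner[OF x q, of "q * s * q"] qq by (metis mult.assoc)
  have eq: "e * q = e" "q * e = e" "e * e = e" using e by (simp_all add: below_def idem_def)
  have i: "(q - e) * (q - e) = q - e" "(q - e) * q = q - e"
    by (simp_all add: algebra_simps eq qq)
  have tt: "q - q * s * q = q * t * q"
  proof -
    have "q = q * (s + t) * q" using st qq by simp
    thus ?thesis by (simp add: algebra_simps)
  qed
  have "e = e * e * e" by (simp add: eq)
  also have "\<dots> = e * (q * s * q * u) * e" by (metis e(3))
  also have "\<dots> = e * s * (q * u) * e"
    by (simp add: mult.assoc eq eq[THEN mult_eq_left])
  finally have 1: "e = e * s * (q * u) * e" .
  have "q - e = (q - e) * (q - e) * (q - e)" by (simp add: i)
  also have "\<dots> = (q - e) * (q * t * q * v) * (q - e)" by (metis e(4) tt)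
  also have "\<dots> = ((q - e) * q) * t * (q * v) * (q - e)" by (simp only: mult.assoc)
  also have "\<dots> = (q - e) * t * (q * v) * (q - e)" by (simp only: i)
  finally have 2: "q - e = (q - e) * t * (q * v) * (q - e)" .
  show ?thesis using that[OF e(1,2) 1 2] .
qed

text \<open>Built one summand at a time, so that rule induction works through the terms of an
  expression of \<open>1\<close>.\<close>

inductive_set ideal_gen :: "'a::ring_1 set \<Rightarrow> 'a set" for S where
  zero: "0 \<in> ideal_gen S"
| step: "x \<in> ideal_gen S \<Longrightarrow> s \<in> S \<Longrightarrow> x + a * s * b \<in> ideal_gen S"

lemma ideal_gen_add:
  assumes "x \<in> ideal_gen S" "y \<in> ideal_gen S"
  shows "x + y \<in> ideal_gen S"
  using assms(2)
proof induction
  case zero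
  thus ?case using assms by simp
next
  case (step y s a b)
  have "x + (y + a * s * b) = (x + y) + a * s * b" by (simp add: add.assoc)
  thus ?case using step ideal_gen.step by metis
qed

lemma ideal_gen_mult:
  assumes "x \<in> ideal_gen S"
  shows "a * x * b \<in> ideal_gen S"
  using assms
proof induction
  case zero
  thus ?case by (simp add: ideal_gen.zero)
next
  case (step y s c d)
  have "a * (y + c * s * d) * b = a * y * b + (a * c) * s * (d * b)"
    by (simp add: algebra_simps)
  thus ?case using step ideal_gen.step by metis
qed

lemma ideal_gen_left: "x \<in> ideal_gen S \<Longrightarrow> a * x \<in> ideal_gen S"
  using ideal_gen_mult[of x S a 1] by simp

lemma ideal_gen_right: "x \<in> ideal_gen S \<Longrightarrow> x * a \<in> ideal_gen S"
  using ideal_gen_mult[of x S 1 a] by simp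

lemma ideal_gen_minus: "x \<in> ideal_gen S \<Longrightarrow> - x \<in> ideal_gen S"
  using ideal_gen_left[of x S "-1"] by simp

lemma ideal_gen_diff: "x \<in> ideal_gen S \<Longrightarrow> y \<in> ideal_gen S \<Longrightarrow> x - y \<in> ideal_gen S"
  using ideal_gen_add[of x S "-y"] ideal_gen_minus[of y S] by simp

lemma ideal_gen_base: "s \<in> S \<Longrightarrow> s \<in> ideal_gen S"
  using ideal_gen.step[OF ideal_gen.zero, of s S 1 1] by simp

lemma ideal_gen_subset:
  assumes "S \<subseteq> ideal_gen T"
  shows "ideal_gen S \<subseteq> ideal_gen T"
proof
  fix x assume "x \<in> ideal_gen S"
  thus "x \<in> ideal_gen T"
    by induction (use assms in \<open>auto intro: ideal_gen.zero ideal_gen_add ideal_gen_mult\<close>)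
qed

section \<open>Two orthogonal equivalent idempotents generating the whole ring\<close>

definition pair :: "'a::ring_1 \<Rightarrow> 'a \<Rightarrow> bool" where
  "pair y y' \<longleftrightarrow> idem y \<and> idem y' \<and> orth y y' \<and> equivalent y y'"

text \<open>Modulo the ideal generated by \<open>y\<close>, the idempotent \<open>g\<close> lifts to some \<open>e\<close> below
  \<open>c = 1 - y - y'\<close>; the part of \<open>E\<close> not already in that ideal is then equivalent to idempotents
  below \<open>e\<close> and below \<open>c - e\<close>, which are added to \<open>y\<close> and \<open>y'\<close>.\<close>

lemma pair_grow:
  fixes E :: "'a::ring_1"
  assumes x: "exchange TYPE('a)" and p: "pair y y'" and E: "idem E" and g: "idem g"
    and Eg: "E = u * (g * h * (1 - g)) * v"
  obtains y1 y1' where "pair y1 y1'" "y \<in> ideal_gen {y1}" "E \<in> ideal_gen {y1}"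
proof -
  define c where "c = 1 - y - y'"
  let ?J = "ideal_gen {y}"
  note I = ideal_gen_diff ideal_gen_add ideal_gen_mult ideal_gen_left ideal_gen_right
  have y: "y * y = y" "y' * y' = y'" "y * y' = 0" "y' * y = 0"
    using p by (auto simp: pair_def idem_def orth_def)
  have yJ: "y \<in> ?J" by (simp add: ideal_gen_base)
  obtain s s' where s: "s * s' = y" "s' * s = y'" "y * s = s" "s' * y = s'"
    using p unfolding pair_def equivalent_def by blast
  have "y' = s' * y * s" by (simp add: s)
  hence y'J: "y' \<in> ?J" using yJ I by metis
  have cJ: "c - 1 \<in> ?J"
  proof -
    have "c - 1 = - (y + y')" by (simp add: c_def)
    thus ?thesis using yJ y'J by (metis ideal_gen_add ideal_gen_minus)
  qed
  have cc: "c * c = c" by (simp add: c_def algebra_simps y)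
  have cy: "orth y c" "orth y' c" by (simp_all add: orth_def c_def algebra_simps y)
  have gg: "g * g = g" using g by (simp add: idem_def)
  have ic: "idem c" and cgc: "c * (c * g * c) = c * g * c" "c * g * c * c = c * g * c"
    by (simp_all add: idem_def mult.assoc cc cc[THEN mult_eq_left])
  obtain e r t where e: "idem e" "below e c" "e = (c * g * c) * r" "c - e = (c - c * g * c) * t"
    using exchange_corner[OF x, of c "c * g * c"] ic cgc by blast
  \<comment> \<open>Modulo \<open>?J\<close> the element \<open>c\<close> is \<open>1\<close>, so
    \<open>e\<close> is a right multiple of \<open>g\<close> and \<open>1 - e\<close> one of
    \<open>1 - g\<close>; hence \<open>g * e\<close> is congruent both to \<open>e\<close> and to
    \<open>g\<close>.\<close>
  have 1: "g * e - e \<in> ?J"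
  proof -
    have "g * e - e = (g - 1) * (c - 1) * (g * c * r)"
      by (subst (1 2) e(3)) (simp add: algebra_simps gg gg[THEN mult_eq_left])
    thus ?thesis using cJ I by metis
  qed
  have 2: "g * c - g * e \<in> ?J"
  proof -
    have "g * c - g * e = g * (c - e)" by (simp add: algebra_simps)
    also have "\<dots> = g * (c - 1) * ((1 - g) * c * t)"
      by (subst e(4)) (simp add: algebra_simps gg gg[THEN mult_eq_left] cc cc[THEN mult_eq_left])
    finally show ?thesis using cJ I by metis
  qed
  have 3: "g - g * c \<in> ?J"
  proof -
    have "g - g * c = - (g * (c - 1))" by (simp add: algebra_simps)
    thus ?thesis using cJ I ideal_gen_minus by metis
  qed
  have ge: "g - e \<in> ?J"
  proof -
    have "g - e = (g - g * c) + (g * c - g * e) + (g * e - e)" by simp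
    thus ?thesis using 1 2 3 I by metis
  qed
  define e' where "e' = c - e"
  have ge': "(1 - g) - e' \<in> ?J"
  proof -
    have "(1 - g) - e' = - ((c - 1) + (g - e))" by (simp add: e'_def)
    thus ?thesis using cJ ge I ideal_gen_minus by metis
  qed
  have e': "idem e'" "below e' c" "orth e e'"
    using below_diff[of e c] e cc by (auto simp: e'_def idem_def)
  \<comment> \<open>The corner element moved to the orthogonal idempotents \<open>e\<close> and
    \<open>e'\<close>: whatever factors through \<open>w\<close> is subequivalent to both.\<close>
  define w where "w = u * e * h * e' * v"
  have Ew: "E - w \<in> ?J"
  proof -
    have "E - w = u * (g - e) * (h * (1 - g) * v) + (u * e * h) * ((1 - g) - e') * v"
      by (simp add: Eg w_def algebra_simps)
    thus ?thesis using ge ge' I by metis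
  qed
  obtain F a b where F: "idem F" "below F E" "F = F * w * a * F" "E - F = (E - F) * (E - w) * b * (E - F)"
    using exchange_split[OF x E, of w "E - w"] by auto
  have EF: "E - F \<in> ?J"
    using F(4) Ew I by metis
  have s1: "subequiv F e"
    by (rule subequiv_factor[OF F(1) e(1), of u "h * e' * v * a"])
      (use F(3) in \<open>simp add: w_def mult.assoc\<close>)
  have s2: "subequiv F e'"
    by (rule subequiv_factor[OF F(1) e'(1), of "u * e * h" "v * a"])
      (use F(3) in \<open>simp add: w_def mult.assoc\<close>)
  obtain z where z: "equivalent F z" "idem z" "below z e" using s1 F(1) by (rule subequivE)
  obtain z' where z': "equivalent F z'" "idem z'" "below z' e'" using s2 F(1) by (rule subequivE)
  have zc: "below z c" "below z' c" using z z' e e' below_trans by blast+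
  have oz: "orth z z'" using z z' e' by (meson orth_below2)
  have o1: "orth y z" "orth y' z'" "orth y z'" "orth y' z"
    using cy zc by (meson orth_below orth_sym)+
  have "equivalent (y + z) (y' + z')"
    by (rule equivalent_add)
      (use p z z' o1 in \<open>auto simp: pair_def intro: equivalent_trans equivalent_sym\<close>)
  moreover have "orth (y + z) (y' + z')"
    using p oz o1 by (metis orth_add orth_sym pair_def)
  ultimately have P: "pair (y + z) (y' + z')"
    using p z z' o1 by (simp add: pair_def idem_add)
  let ?K = "ideal_gen {y + z}"
  have yK: "y \<in> ?K"
  proof -
    have "y = y * (y + z)" using o1 y by (simp add: orth_def distrib_left)
    thus ?thesis using I ideal_gen_base by (metis singletonI)
  qed
  hence JK: "?J \<subseteq> ?K" by (intro ideal_gen_subset) simp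
  have zK: "z \<in> ?K"
  proof -
    have "z = z * (y + z)" using o1 z by (simp add: orth_def idem_def distrib_left)
    thus ?thesis using I ideal_gen_base by (metis singletonI)
  qed
  have "F \<in> ?K"
  proof -
    obtain k l where "k * l = F" "k * z = k" using z(1) by (auto simp: equivalent_def)
    hence "F = k * z * l" by simp
    thus ?thesis using zK I by metis
  qed
  hence "E \<in> ?K" using EF JK I by (metis add_diff_cancel_left' add_diff_eq diff_add_cancel subsetD)
  thus ?thesis using that P yK by blast
qed

text \<open>Invariant \<open>1 = j + t * r\<close>: \<open>j\<close> already lies in the ideal of
  \<open>y\<close>, and \<open>t\<close> holds the summands still to be used. Exchange for one
  summand yields \<open>E\<close>, which \<open>pair_grow\<close> absorbs, while
  \<open>1 - E\<close> is a right multiple of \<open>j + t * r\<close>. The multiplier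
  \<open>r\<close> changes at each stage, so it is quantified.\<close>

lemma full_pair:
  assumes x: "exchange TYPE('a::ring_1)"
    and 1: "(1::'a::ring_1) \<in> ideal_gen {g * h * (1 - g) | g h. idem g}"
  obtains y y' :: "'a::ring_1" where "pair y y'" "1 \<in> ideal_gen {y}"
proof -
  have *: "\<forall>y y' j r. pair y y' \<longrightarrow> j \<in> ideal_gen {y} \<longrightarrow> 1 = j + t * r \<longrightarrow>
      (\<exists>y y'::'a. pair y y' \<and> 1 \<in> ideal_gen {y})"
    if "t \<in> ideal_gen {g * h * (1 - g) | g h. idem g}" for t :: 'a
    using that
  proof induction
    case zero
    show ?case by auto
  next
    case (step t s a b)
    show ?case
    proof (intro allI impI)
      fix y y' j r
      assume p: "pair y y'" and j: "j \<in> ideal_gen {y}" and e: "1 = j + (t + a * s * b) * r"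
      obtain g h where gh: "idem g" "s = g * h * (1 - g)" using step.hyps by auto
      obtain E u v where E: "idem E" "E = a * s * b * r * u" "1 - E = (1 - a * s * b * r) * v"
        using x unfolding exchange_def by metis
      have "E = a * (g * h * (1 - g)) * (b * r * u)" using E gh by (simp add: mult.assoc)
      then obtain y1 y1' where y1: "pair y1 y1'" "y \<in> ideal_gen {y1}" "E \<in> ideal_gen {y1}"
        using pair_grow[OF x p E(1) gh(1)] by metis
      have "1 - a * s * b * r = j + t * r" using e by (simp add: algebra_simps)
      hence "1 - E = (j + t * r) * v" using E(3) by simp
      hence "1 = (E + j * v) + t * (r * v)" by (simp add: algebra_simps)
      moreover have "j \<in> ideal_gen {y1}" using j y1(2) ideal_gen_subset[of "{y}" "{y1}"] by auto
      hence "E + j * v \<in> ideal_gen {y1}" using y1 by (simp add: ideal_gen_add ideal_gen_right)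
      ultimately show "\<exists>y y'::'a. pair y y' \<and> 1 \<in> ideal_gen {y}"
        using step.IH[rule_format, OF y1(1)] by blast
    qed
  qed
  have "pair 0 (0::'a)" by (auto simp: pair_def idem_def orth_def equivalent_def)
  moreover have "(1::'a) = 0 + 1 * 1" by simp
  ultimately obtain y y' :: 'a where "pair y y'" "1 \<in> ideal_gen {y}"
    using *[OF 1] ideal_gen.zero by metis
  thus ?thesis using that by blast
qed

section \<open>Block decompositions of the unit and commutators\<close>

definition triple :: "'a::ring_1 \<Rightarrow> 'a \<Rightarrow> 'a \<Rightarrow> bool" where
  "triple y y' c \<longleftrightarrow> pair y y' \<and> idem c \<and> orth c y \<and> orth c y' \<and> subequiv c y"

text \<open>The part of \<open>c\<close> that embeds into the copy \<open>F\<close> of \<open>b\<close> is matched with the corresponding part of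
  \<open>b\<close> and moved to \<open>y\<close> and \<open>y'\<close>; what remains of \<open>c\<close> and \<open>b\<close> embeds disjointly into \<open>y\<close>.\<close>

lemma triple_merge:
  fixes y :: "'a::ring_1"
  assumes x: "exchange TYPE('a)" and t: "triple y y' c"
    and b: "idem b" "orth b y" "orth b y'" "orth b c" "subequiv b y"
  obtains y1 y1' c1 where "triple y1 y1' c1" "y1 + y1' + c1 = y + y' + c + b" "below y y1"
proof -
  have y: "idem y" "idem y'" "orth y y'" "equivalent y y'" "idem c" "orth c y" "orth c y'" "subequiv c y"
    using t by (auto simp: triple_def pair_def)
  \<comment> \<open>Both \<open>c\<close> and \<open>b\<close> embed in \<open>y\<close>, but their
    images may overlap, so \<open>c + b\<close> need not embed. \<open>F\<close> is the image of
    \<open>b\<close>; only \<open>G\<close> is free for \<open>c\<close>.\<close>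
  obtain F where F: "equivalent b F" "idem F" "below F y" using b by (meson subequivE)
  define G where "G = y - F"
  have G: "idem G" "orth F G" "below G y" using below_diff[OF F(2) y(1) F(3)] by (auto simp: G_def)
  obtain k l where kl: "k * l = c" "c * k = k" "k * y = k" "y * l = l" "l * c = l"
    using y by (auto simp: subequiv_def)
  have csum: "c = k * F * l + k * G * l"
    using kl by (simp add: G_def algebra_simps)
  obtain p u v where p: "idem p" "below p c" "p = p * (k * F * l) * u * p"
      "c - p = (c - p) * (k * G * l) * v * (c - p)"
    using exchange_split[OF x y(5) csum] by blast
  define p2 where "p2 = c - p"
  have p2: "idem p2" "orth p p2" "below p2 c" using below_diff[OF p(1) y(5) p(2)] by (auto simp: p2_def)
  have "subequiv p F"
    by (rule subequiv_factor[OF p(1) F(2), of k "l * u"]) (use p(3) in \<open>simp add: mult.assoc\<close>)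
  then obtain P where P: "equivalent p P" "idem P" "below P F" using p(1) by (rule subequivE)
  have sp2: "subequiv p2 G"
    by (rule subequiv_factor[OF p2(1) G(1), of k "l * v"]) (use p(4) in \<open>simp add: p2_def mult.assoc\<close>)
  define Q where "Q = F - P"
  have Q: "idem Q" "orth P Q" "below Q F" using below_diff[OF P(2) F(2) P(3)] by (auto simp: Q_def)
  obtain m n where mn: "m * n = b" "n * m = F" "b * m = m" "m * F = m" "F * n = n" "n * b = n"
    using F by (auto simp: equivalent_def)
  have PF: "P * F = P" "F * P = P" "Q * F = Q" "F * Q = Q" "P * P = P" "Q * Q = Q" "P * Q = 0" "Q * P = 0"
    using P Q by (simp_all add: below_def idem_def orth_def)
  note [simp] = mn PF mn[THEN mult_eq_left] PF[THEN mult_eq_left]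
  define q where "q = m * P * n"
  define q2 where "q2 = m * Q * n"
  have q: "idem q" "idem q2" "orth q q2" "below q b" "below q2 b"
    by (simp_all add: q_def q2_def idem_def orth_def below_def mult.assoc)
  have qs: "q + q2 = b" by (simp add: q_def q2_def Q_def algebra_simps)
  have qP: "equivalent q P"
    unfolding equivalent_def
    by (rule exI[of _ "m * P"], rule exI[of _ "P * n"]) (simp add: q_def mult.assoc)
  have q2Q: "equivalent q2 Q"
    unfolding equivalent_def
    by (rule exI[of _ "m * Q"], rule exI[of _ "Q * n"]) (simp add: q2_def mult.assoc)
  have o: "orth p y" "orth p y'" "orth p2 y" "orth p2 y'" "orth q y" "orth q y'" "orth q2 y" "orth q2 y'"
    "orth q p" "orth q p2" "orth q2 p" "orth q2 p2"
    using y b p p2 q by (meson orth_below orth_below2)+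
  have "equivalent (y + p) (y' + q)"
    by (rule equivalent_add)
      (use y P qP o in \<open>auto intro: equivalent_trans equivalent_sym orth_sym\<close>)
  moreover have "orth (y + p) (y' + q)"
    using y o by (metis orth_add orth_sym)
  ultimately have pr: "pair (y + p) (y' + q)"
    using y o p q by (simp add: pair_def idem_add orth_sym)
  have by1: "below y (y + p)" using y o by (simp add: below_add_orth orth_sym)
  have GQ: "orth G Q" using G Q by (meson orth_below orth_sym)
  have "subequiv (p2 + q2) (G + Q)"
    using sp2 q2Q p2 q o GQ G Q by (simp add: equivalent_imp_subequiv orth_sym subequiv_add)
  moreover have "below (G + Q) (y + p)"
    using G Q F by1 by (meson below_add below_trans)
  ultimately have s: "subequiv (p2 + q2) (y + p)" by (rule subequiv_mono)
  have "orth (p2 + q2) (y + p)" "orth (p2 + q2) (y' + q)"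
    using o p2 q by (metis orth_add orth_sym)+
  hence "triple (y + p) (y' + q) (p2 + q2)"
    using pr s p2 q o by (simp add: triple_def idem_add orth_sym)
  moreover have "(y + p) + (y' + q) + (p2 + q2) = y + y' + c + b"
    by (simp add: qs[symmetric] p2_def)
  ultimately show ?thesis using that by1 by blast
qed

text \<open>Invariant \<open>b = b * t * r\<close> for the uncovered idempotent \<open>b\<close>.
  One summand \<open>k * y0 * l\<close> of \<open>t\<close> splits off a piece of \<open>b\<close>
  that embeds in \<open>y0\<close>, hence in the current \<open>y\<close> because
  \<open>below y0 y\<close> is maintained, and \<open>triple_merge\<close> absorbs it. At
  \<open>t = 0\<close> nothing of \<open>b\<close> is left.\<close>

lemma full_triple:
  assumes x: "exchange TYPE('a::ring_1)"
    and 1: "(1::'a::ring_1) \<in> ideal_gen {g * h * (1 - g) | g h. idem g}"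
  obtains y y' c :: "'a::ring_1" where "triple y y' c" "y + y' + c = 1"
proof -
  obtain y0 y0' :: 'a where y0: "pair y0 y0'" "1 \<in> ideal_gen {y0}"
    using full_pair[OF x 1] .
  have *: "\<forall>y y' c b r. triple y y' c \<longrightarrow> below y0 y \<longrightarrow> idem b \<longrightarrow> orth b y \<longrightarrow> orth b y' \<longrightarrow>
       orth b c \<longrightarrow> y + y' + c + b = 1 \<longrightarrow> b = b * t * r \<longrightarrow> (\<exists>y y' c::'a. triple y y' c \<and> y + y' + c = 1)"
    if "t \<in> ideal_gen {y0}" for t
    using that
  proof induction
    case zero
    show ?case by auto
  next
    case (step t s k l)
    show ?case
    proof (intro allI impI)
      fix y y' c b r
      assume t: "triple y y' c" and yy: "below y0 y" and b: "idem b" "orth b y" "orth b y'" "orth b c"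
        and sum: "y + y' + c + b = 1" and e: "b = b * (t + k * s * l) * r"
      have s: "s = y0" using step.hyps by simp
      have bsum: "b = b * k * y0 * l * r + b * t * r" using e s by (simp add: algebra_simps)
      obtain p u v where p: "idem p" "below p b" "p = p * (b * k * y0 * l * r) * u * p"
        "b - p = (b - p) * (b * t * r) * v * (b - p)"
        using exchange_split[OF x b(1) bsum] by blast
      define p2 where "p2 = b - p"
      have p2: "idem p2" "orth p p2" "below p2 b" using below_diff[OF p(1) b(1) p(2)] by (auto simp: p2_def)
      have i0: "idem y0" using y0 by (simp add: pair_def)
      have "subequiv p y0"
        by (rule subequiv_factor[OF p(1) i0, of "b * k" "l * r * u"]) (use p(3) in \<open>simp add: mult.assoc\<close>)
      hence sp: "subequiv p y" using yy subequiv_mono by blast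
      have "orth p y" "orth p y'" "orth p c" using b p by (meson orth_below)+
      then obtain y1 y1' c1 where t1: "triple y1 y1' c1" "y1 + y1' + c1 = y + y' + c + p" "below y y1"
        using triple_merge[OF x t p(1) _ _ _ sp] by metis
      have s1: "y1 + y1' + c1 + p2 = 1" using t1 sum by (simp add: p2_def)
      have z: "p2 * p2 = p2" using p2 by (simp add: idem_def)
      have u1: "idem y1" "idem y1'" "idem c1" "orth y1 y1'" "orth c1 y1" "orth c1 y1'"
        using t1 by (auto simp: triple_def pair_def)
      have e2: "p2 = 1 - (y1 + y1' + c1)" using s1 by (simp add: algebra_simps)
      have o: "orth p2 y1" "orth p2 y1'" "orth p2 c1"
        unfolding e2 using u1 by (simp_all add: orth_def idem_def algebra_simps)
      have p2e: "p2 = p2 * t * (r * v * p2)"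
      proof -
        have "p2 = p2 * (b * t * r) * v * p2" using p(4) by (simp add: p2_def)
        moreover have "p2 * b = p2" using p2 by (simp add: below_def)
        ultimately show ?thesis by (metis mult.assoc)
      qed
      have "below y0 y1" using yy t1 below_trans by blast
      thus "\<exists>y y' c::'a. triple y y' c \<and> y + y' + c = 1"
        using step.IH[rule_format, OF t1(1) _ p2(1) o s1 p2e] by blast
    qed
  qed
  define b where "b = 1 - y0 - y0'"
  have y: "y0 * y0 = y0" "y0' * y0' = y0'" "y0 * y0' = 0" "y0' * y0 = 0"
    using y0 by (auto simp: pair_def idem_def orth_def)
  have b: "idem b" "orth b y0" "orth b y0'" "orth b 0"
    by (simp_all add: b_def idem_def orth_def algebra_simps y)
  have "triple y0 y0' 0"
    using y0 by (auto simp: triple_def idem_def orth_def subequiv_def intro: exI[of _ 0])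
  moreover have "below y0 y0" by (simp add: below_def y)
  moreover have "y0 + y0' + 0 + b = 1" by (simp add: b_def)
  moreover have "b = b * 1 * 1" by simp
  ultimately show ?thesis using *[OF y0(2)] b that by blast
qed

text \<open>\<open>y - y'\<close> is the diagonal matrix with entries 1, -1, 0. Commutation with it
  multiplies each block by the difference of its two entries, which off the diagonal is 1, -1, 2 or
  -2; \<open>w\<close> divides by that difference.\<close>

lemma commutator_zero_diagonal:
  fixes y z :: "'a::real_algebra_1"
  assumes "triple y y' c" "y + y' + c = 1" and z: "y * z * y = 0" "y' * z * y' = 0" "c * z * c = 0"
  shows "z \<in> commutators"
proof -
  have y: "y * y = y" "y' * y' = y'" "c * c = c" "y * y' = 0" "y' * y = 0" "c * y = 0" "y * c = 0"
     "c * y' = 0" "y' * c = 0"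
    using assms(1) by (auto simp: triple_def pair_def idem_def orth_def)
  define w where "w = (1/2) *\<^sub>R (y * z * y') + y * z * c - (1/2) *\<^sub>R (y' * z * y) - y' * z * c - c * z * y + c * z * y'"
  have "z = (y + y' + c) * z * (y + y' + c)" using assms by simp
  also have "\<dots> = y * z * y' + y * z * c + y' * z * y + y' * z * c + c * z * y + c * z * y'"
    using z by (simp add: algebra_simps)
  also have "\<dots> = commutator (y - y') w"
    by (simp add: commutator_def w_def algebra_simps y y[THEN mult_eq_left] scaleR_add_left[symmetric])
  finally show ?thesis unfolding commutators_def by blast
qed

lemma commutator_decomposition:
  fixes x y :: "'a::real_algebra_1"
  assumes t: "triple y y' c" and sum: "y + y' + c = 1"
  shows "\<exists>u v z d w. u \<in> commutators \<and> v \<in> commutators \<and> z \<in> commutators \<and> d \<in> commutators \<and>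
     w \<in> commutators \<and> x = z + u * v \<and> z = d * w"
proof -
  have y: "y * y = y" "y' * y' = y'" "c * c = c" "y * y' = 0" "y' * y = 0" "c * y = 0" "y * c = 0"
     "c * y' = 0" "y' * c = 0"
    using t by (auto simp: triple_def pair_def idem_def orth_def)
  obtain a b where ab: "a * b = c" "c * a = a" "a * y = a" "y * b = b" "b * c = b"
    using t by (auto simp: triple_def subequiv_def)
  obtain s r where sr: "s * r = y" "r * s = y'" "y * s = s" "s * y' = s" "y' * r = r" "r * y = r"
    using t by (auto simp: triple_def pair_def equivalent_def)
  have o: "c * s = 0" "c * r = 0" "s * c = 0" "r * c = 0" "y * a = 0" "y' * a = 0" "a * c = 0" "a * y' = 0"
     "c * b = 0" "y' * b = 0" "b * y = 0" "b * y' = 0" "y' * s = 0" "s * y = 0" "y * r = 0" "r * y' = 0"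
     "s * s = 0" "r * r = 0" "a * r = 0" "s * b = 0" "b * s = 0" "r * a = 0" "s * a = 0" "b * r = 0"
    by (blast intro: mult_zero_units y ab sr)+
  note S = y ab sr o y[THEN mult_eq_left] ab[THEN mult_eq_left] sr[THEN mult_eq_left] o[THEN mult_eq_left]
  \<comment> \<open>\<open>u\<close> sends each diagonal block of \<open>x\<close> off the diagonal
    and \<open>v\<close> brings it back: \<open>c * x * a * b = c * x * c\<close>,
    \<open>y * x * s * r = y * x * y\<close>, \<open>y' * x * r * s = y' * x * y'\<close>. The other
    products vanish or are off the diagonal.\<close>
  define u where "u = c * x * a + y * x * s + y' * x * r"
  define v where "v = b + r + s"
  define z where "z = x - u * v"
  \<comment> \<open>The commutator of \<open>a + s\<close> and \<open>b + 2 *\<^sub>R r\<close>. The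
    factor 2 keeps it invertible: on \<open>y\<close> it is \<open>2 *\<^sub>R y - b * a\<close>,
    which is 1 on the copy \<open>b * a\<close> of \<open>c\<close> and 2 on the rest, where factor
    1 would give 0 on \<open>b * a\<close>. The inverse \<open>d'\<close> is block diagonal, so
    \<open>d' * z\<close> keeps zero diagonal.\<close>
  define d where "d = c - b * a + 2 *\<^sub>R y - 2 *\<^sub>R y'"
  define d' where "d' = c + (1/2) *\<^sub>R (y + b * a) - (1/2) *\<^sub>R y'"
  define w where "w = d' * z"
  have u: "u \<in> commutators"
    by (rule commutator_zero_diagonal[OF t sum]) (simp_all add: u_def algebra_simps S)
  have v: "v \<in> commutators"
    by (rule commutator_zero_diagonal[OF t sum]) (simp_all add: v_def algebra_simps S)
  have zd: "y * z * y = 0" "y' * z * y' = 0" "c * z * c = 0"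
    by (simp_all add: z_def u_def v_def algebra_simps S)
  have z: "z \<in> commutators"
    by (rule commutator_zero_diagonal[OF t sum zd])
  have d'c: "c * d' = c" "y * d' = (1/2) *\<^sub>R (y + b * a) * y" "y' * d' = - (1/2) *\<^sub>R y'"
    by (simp_all add: d'_def algebra_simps S)
  have w: "w \<in> commutators"
  proof (rule commutator_zero_diagonal[OF t sum])
    show "c * w * c = 0"
      using zd by (simp add: w_def mult.assoc[symmetric] d'c)
    show "y' * w * y' = 0"
      using zd by (simp add: w_def mult.assoc[symmetric] d'c)
    have "y * w * y = (1/2) *\<^sub>R (y + b * a) * (y * z * y)"
      by (simp add: w_def mult.assoc[symmetric] d'c)
    thus "y * w * y = 0" using zd by simp
  qed
  have "d = commutator (a + s) (b + 2 *\<^sub>R r)"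
    by (simp add: d_def commutator_def algebra_simps S)
  hence d: "d \<in> commutators" unfolding commutators_def by blast
  have half: "(1/2) *\<^sub>R q + (1/2) *\<^sub>R q = q" for q :: 'a
    by (simp add: scaleR_add_left[symmetric])
  have "d * d' = c + y + y'"
    by (simp add: d_def d'_def algebra_simps S half)
  hence "d * d' = 1" using sum by (simp add: algebra_simps)
  hence "z = d * w" by (simp add: w_def mult.assoc[symmetric])
  moreover have "x = z + u * v" by (simp add: z_def)
  ultimately show ?thesis using u v z d w by blast
qed

theorem exchange_commutator_products:
  assumes x: "exchange TYPE('a::real_algebra_1)"
    and 1: "(1::'a::real_algebra_1) \<in> ideal_gen {g * h * (1 - g) | g h. idem g}"
  shows "xi_le 3 TYPE('a::real_algebra_1) \<and>
         (UNIV :: 'a::real_algebra_1 set) = set_sum commutators (set_prod commutators commutators)"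
proof -
  obtain y y' c :: 'a where t: "triple y y' c" "y + y' + c = 1" using full_triple[OF x 1] .
  note D = commutator_decomposition[OF t]
  have "\<exists>b c d e :: nat \<Rightarrow> 'a. x = (\<Sum>i<2. commutator (b i) (c i) * commutator (d i) (e i))" for x
  proof -
    obtain u v d w where *: "u \<in> commutators" "v \<in> commutators" "d \<in> commutators" "w \<in> commutators"
      "x = d * w + u * v" using D[of x] by metis
    obtain u1 u2 v1 v2 d1 d2 w1 w2 where "u = commutator u1 u2" "v = commutator v1 v2"
       "d = commutator d1 d2" "w = commutator w1 w2"
      using * unfolding commutators_def by blast
    with * have "x = (\<Sum>i<2. commutator (if i = 0 then d1 else u1) (if i = 0 then d2 else u2) *
         commutator (if i = 0 then w1 else v1) (if i = (0::nat) then w2 else v2))"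
      by (simp add: numeral_2_eq_2)
    thus ?thesis
      by (intro exI[of _ "\<lambda>i::nat. if i = 0 then d1 else u1"] exI[of _ "\<lambda>i::nat. if i = 0 then d2 else u2"]
          exI[of _ "\<lambda>i::nat. if i = 0 then w1 else v1"] exI[of _ "\<lambda>i::nat. if i = 0 then w2 else v2"])
  qed
  hence "xi_le 3 TYPE('a)" unfolding xi_le_def by (intro exI[of _ 2]) auto
  moreover have "x \<in> set_sum commutators (set_prod commutators commutators)" for x :: 'a
    using D[of x] unfolding set_sum_def set_prod_def by blast
  ultimately show ?thesis by blast
qed

section \<open>Self-adjoint elements of finite spectrum\<close>

lemma norm_mult3_le: "norm (a * b * c) \<le> norm a * norm b * norm (c::'a::real_normed_algebra)"
  by (meson mult_right_mono norm_ge_zero norm_mult_ineq order_trans)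

lemma invertible_el_mult:
  assumes "invertible_el a" "invertible_el b"
  shows "invertible_el (a * b)"
proof -
  obtain c d where "a * c = 1" "c * a = 1" "b * d = 1" "d * b = 1"
    using assms by (auto simp: invertible_el_def)
  hence "(a * b) * (d * c) = 1" "(d * c) * (a * b) = 1"
    by (simp_all add: mult.assoc mult_eq_left)
  thus ?thesis unfolding invertible_el_def by blast
qed

lemma power_mult_commuting:
  fixes a b :: "'a::monoid_mult"
  assumes "a * b = b * a"
  shows "(a * b) ^ n = a ^ n * b ^ n"
proof (induction n)
  case (Suc n)
  have "b * a ^ n = a ^ n * b" using power_commuting_commutes[of a b n] assms by simp
  thus ?case using Suc by (metis mult.assoc power_Suc)
qed simp

lemma invertible_el_near_one:
  fixes x :: "'a::{banach,real_normed_algebra_1}"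
  assumes "norm (1 - x) < 1"
  shows "invertible_el x"
proof -
  define t where "t = 1 - x"
  have s: "summable (\<lambda>n. t ^ n)" using assms by (simp add: t_def complete_algebra_summable_geometric)
  define S where "S = (\<Sum>n. t ^ n)"
  have "S = 1 + (\<Sum>n. t ^ Suc n)"
    unfolding S_def using suminf_split_head[OF s] by simp
  moreover have "(\<Sum>n. t ^ Suc n) = t * S" "(\<Sum>n. t ^ Suc n) = S * t"
    unfolding S_def using suminf_mult[OF s, of t] suminf_mult2[OF s, of t]
    by (simp_all add: power_commutes)
  ultimately have "S = 1 + t * S" "S = 1 + S * t" by simp_all
  hence "x * S = 1" "S * x = 1" by (simp_all add: t_def algebra_simps)
  thus ?thesis unfolding invertible_el_def by blast
qed

section \<open>Elementary rules in C*-algebras\<close>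

locale cstar =
  fixes sc :: "complex \<Rightarrow> 'a::{banach,real_normed_algebra_1} \<Rightarrow> 'a" and st :: "'a \<Rightarrow> 'a"
  assumes cstar: "cstar_algebra sc st"
begin

lemma sc_of_real: "sc (complex_of_real r) a = r *\<^sub>R a"
  and sc_add_left: "sc (z + w) a = sc z a + sc w a"
  and sc_add_right: "sc z (a + b) = sc z a + sc z b"
  and sc_sc: "sc z (sc w a) = sc (z * w) a"
  and sc_mult_left: "sc z a * b = sc z (a * b)"
  and sc_mult_right: "a * sc z b = sc z (a * b)"
  and norm_sc: "norm (sc z a) = cmod z * norm a"
  and st_add: "st (a + b) = st a + st b"
  and st_sc: "st (sc z a) = sc (cnj z) (st a)"
  and st_mult: "st (a * b) = st b * st a"
  and st_st: "st (st a) = a"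
  and norm_st_mult: "norm (st a * a) = (norm a)\<^sup>2"
  using cstar unfolding cstar_algebra_def by metis+

lemma sc_0_left [simp]: "sc 0 a = 0" and sc_1_left [simp]: "sc 1 a = a"
  using sc_of_real[of 0 a] sc_of_real[of 1 a] by simp_all

lemma sc_0_right [simp]: "sc z 0 = 0"
  using sc_add_right[of z 0 0] by simp

lemma sc_minus_left: "sc (- z) a = - sc z a"
  using sc_add_left[of z "-z" a] by (simp add: eq_neg_iff_add_eq_0 add.commute)

lemma sc_minus_right: "sc z (- a) = - sc z a"
  using sc_add_right[of z a "-a"] by (simp add: eq_neg_iff_add_eq_0 add.commute)

lemma sc_diff_left: "sc (z - w) a = sc z a - sc w a"
  using sc_add_left[of z "-w" a] by (simp add: sc_minus_left)

lemma sc_diff_right: "sc z (a - b) = sc z a - sc z b"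
  using sc_add_right[of z a "-b"] by (simp add: sc_minus_right)

lemma sc_eq_0_iff: "sc z a = 0 \<longleftrightarrow> z = 0 \<or> a = 0"
  using norm_sc[of z a] by (metis mult_eq_0_iff norm_eq_zero)

lemma st_0 [simp]: "st 0 = 0"
  using st_add[of 0 0] by simp

lemma st_1 [simp]: "st 1 = 1"
  using st_mult[of "st 1" 1] by (simp add: st_st)

lemma st_minus: "st (- a) = - st a"
  using st_add[of a "-a"] by (simp add: eq_neg_iff_add_eq_0 add.commute)

lemma st_diff: "st (a - b) = st a - st b"
  using st_add[of a "-b"] by (simp add: st_minus)

lemma st_scaleR: "st (r *\<^sub>R a) = r *\<^sub>R st a"
  using st_sc[of "complex_of_real r" a] by (simp add: sc_of_real)

lemma st_power: "st (a ^ n) = st a ^ n"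
  by (induction n) (simp_all add: st_mult power_commutes)

lemma st_sum: "st (\<Sum>i\<in>I. f i) = (\<Sum>i\<in>I. st (f i))"
  by (induction I rule: infinite_finite_induct) (simp_all add: st_add)

lemma norm_st: "norm (st a) = norm a"
proof -
  have "norm a \<le> norm (st a)" for a
  proof (cases "a = 0")
    case False
    have "norm a * norm a \<le> norm (st a) * norm a"
      using norm_mult_ineq[of "st a" a] by (simp add: norm_st_mult power2_eq_square)
    thus ?thesis using False by simp
  qed simp
  from this[of a] this[of "st a"] show ?thesis by (simp add: st_st)
qed

lemma st_mult_eq_0: "st a * a = 0 \<Longrightarrow> a = 0"
  using norm_st_mult[of a] by simp

text \<open>The C*-identity doubles exponents, which is why the power estimates run along
  \<open>2 ^ n\<close>.\<close>

lemma norm_power_self_adjoint: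
  assumes "st a = a"
  shows "norm (a ^ (2 ^ n)) = norm a ^ (2 ^ n)"
proof (induction n)
  case (Suc n)
  have "a ^ (2 ^ Suc n) = st (a ^ (2 ^ n)) * a ^ (2 ^ n)"
    by (simp add: st_power assms mult_2 power_add)
  thus ?case using Suc by (simp add: norm_st_mult power_mult[symmetric] mult.commute)
qed simp

lemma norm_projection:
  assumes "e * e = e" "st e = e" "e \<noteq> 0"
  shows "norm e = 1"
  using norm_st_mult[of e] assms by (simp add: power2_eq_square)

text \<open>The Lipschitz constant survives the passage from \<open>2\<^sup>n\<close> to \<open>2\<^sup>n\<^sup>+\<^sup>1\<close> because the inverse of
  \<open>1 - x\<^sup>2\<close> is the average of the inverses of \<open>1 - x\<close> and \<open>1 + x\<close>, and \<open>1 + x\<close> is \<open>1 - x\<close> at a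
  rotated argument. This replaces complex analysis in the spectral radius argument below.\<close>

lemma resolvent_power_lipschitz:
  assumes inv: "\<And>z. invertible_el (1 - sc z c)"
  shows "\<exists>K>0. \<forall>n. \<exists>g. (\<forall>z. g z * (1 - sc (z ^ 2 ^ n) (c ^ 2 ^ n)) = 1 \<and> (1 - sc (z ^ 2 ^ n) (c ^ 2 ^ n)) * g z = 1) \<and>
     (\<forall>z w. cmod z \<le> R \<longrightarrow> cmod w \<le> R \<longrightarrow> norm (g z - g w) \<le> K * cmod (z - w))"
proof -
  obtain f where f: "\<And>z. f z * (1 - sc z c) = 1" "\<And>z. (1 - sc z c) * f z = 1"
    using inv unfolding invertible_el_def by metis
  have res: "f z - f w = sc (z - w) (f z * c * f w)" for z w
  proof -
    have "f z - f w = f z * ((1 - sc w c) * f w) - (f z * (1 - sc z c)) * f w" by (simp add: f)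
    also have "\<dots> = f z * (sc z c - sc w c) * f w" by (simp add: algebra_simps)
    also have "\<dots> = sc (z - w) (f z * c * f w)"
      by (simp add: sc_diff_left[symmetric] sc_mult_left sc_mult_right)
    finally show ?thesis .
  qed
  have bnd: "norm (f z - f w) \<le> cmod (z - w) * (norm (f z) * norm c * norm (f w))" for z w
  proof -
    show ?thesis by (simp add: res norm_sc mult_left_mono norm_mult3_le)
  qed
  have cont: "continuous_on UNIV f"
    unfolding continuous_on_def
  proof
    fix w :: complex
    define C where "C = norm (f w) * norm c"
    have C: "C \<ge> 0" by (simp add: C_def)
    \<comment> \<open>The resolvent identity bounds \<open>norm (f z)\<close> by
      \<open>norm (f w)\<close> plus a multiple of itself; for \<open>z\<close> this close to
      \<open>w\<close> the multiple is at most 1/2. The \<open>+ 1\<close> covers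
      \<open>C = 0\<close>.\<close>
    have ev: "\<forall>\<^sub>F z in at w. norm (f z - f w) \<le> cmod (z - w) * (2 * C * norm (f w))"
    proof -
      have "\<forall>\<^sub>F z in at w. dist z w < 1 / (2 * (C + 1))"
        unfolding eventually_at using C by (intro exI[of _ "1 / (2 * (C + 1))"]) auto
      thus ?thesis
      proof eventually_elim
        case (elim z)
        have "cmod (z - w) * C \<le> 1 / (2 * (C + 1)) * C"
          using elim C by (intro mult_right_mono) (auto simp: dist_norm)
        also have "\<dots> \<le> 1 / 2" using C by (simp add: field_simps)
        finally have h: "cmod (z - w) * C \<le> 1 / 2" .
        have "norm (f z) \<le> norm (f w) + norm (f z - f w)"
          using norm_triangle_ineq[of "f w" "f z - f w"] by simp
        also have "\<dots> \<le> norm (f w) + (cmod (z - w) * C) * norm (f z)"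
          using bnd[of z w] by (simp add: C_def mult_ac)
        also have "\<dots> \<le> norm (f w) + 1 / 2 * norm (f z)"
          using h by (intro add_left_mono mult_right_mono) auto
        finally have "norm (f z) \<le> 2 * norm (f w)" by simp
        hence "cmod (z - w) * (norm (f z) * norm c * norm (f w)) \<le> cmod (z - w) * (2 * norm (f w) * norm c * norm (f w))"
          by (intro mult_left_mono mult_right_mono) auto
        thus ?case using bnd[of z w] by (simp add: C_def mult_ac)
      qed
    qed
    have "((\<lambda>z. cmod (z - w) * (2 * C * norm (f w))) \<longlongrightarrow> cmod (w - w) * (2 * C * norm (f w))) (at w)"
      by (intro tendsto_intros)
    hence "((\<lambda>z. cmod (z - w) * (2 * C * norm (f w))) \<longlongrightarrow> 0) (at w)" by simp
    hence "((\<lambda>z. f z - f w) \<longlongrightarrow> 0) (at w)"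
      using ev by (rule Lim_null_comparison[rotated])
    thus "(f \<longlongrightarrow> f w) (at w within UNIV)" by (simp add: LIM_zero_iff)
  qed
  have "compact (f ` cball 0 R)"
    by (intro compact_continuous_image continuous_on_subset[OF cont]) auto
  hence "bounded (f ` cball 0 R)" by (rule compact_imp_bounded)
  then obtain B where "\<forall>x\<in>f ` cball 0 R. norm x \<le> B" unfolding bounded_iff by blast
  hence B: "norm (f z) \<le> B" if "cmod z \<le> R" for z using that by simp
  define K where "K = max B 0 * norm c * max B 0 + 1"
  have K: "K > 0" by (simp add: K_def add_nonneg_pos)
  have "\<exists>g. (\<forall>z. g z * (1 - sc (z ^ 2 ^ n) (c ^ 2 ^ n)) = 1 \<and> (1 - sc (z ^ 2 ^ n) (c ^ 2 ^ n)) * g z = 1) \<and>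
     (\<forall>z w. cmod z \<le> R \<longrightarrow> cmod w \<le> R \<longrightarrow> norm (g z - g w) \<le> K * cmod (z - w))" for n
  proof (induction n)
    case 0
    have "norm (f z - f w) \<le> K * cmod (z - w)" if "cmod z \<le> R" "cmod w \<le> R" for z w
    proof -
      have "norm (f z) * norm c * norm (f w) \<le> max B 0 * norm c * max B 0"
        using B[OF that(1)] B[OF that(2)] by (intro mult_mono) auto
      also have "\<dots> \<le> K" by (simp add: K_def)
      finally have "cmod (z - w) * (norm (f z) * norm c * norm (f w)) \<le> cmod (z - w) * K"
        by (rule mult_left_mono) simp
      thus ?thesis using bnd[of z w] by (simp add: mult.commute)
    qed
    thus ?case using f by (intro exI[of _ f]) simp
  next
    case (Suc n)
    define N where "N = (2::nat) ^ n"
    have N: "N > 0" by (simp add: N_def)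
    obtain g where g: "\<And>z. g z * (1 - sc (z ^ N) (c ^ N)) = 1" "\<And>z. (1 - sc (z ^ N) (c ^ N)) * g z = 1"
      and gl: "\<And>z w. cmod z \<le> R \<Longrightarrow> cmod w \<le> R \<Longrightarrow> norm (g z - g w) \<le> K * cmod (z - w)"
      using Suc unfolding N_def by blast
    define \<omega> where "\<omega> = cis (pi / real N)"
    have "\<omega> ^ N = cis (real N * (pi / real N))" unfolding \<omega>_def by (rule Complex.DeMoivre)
    also have "real N * (pi / real N) = pi" using N by simp
    finally have \<omega>: "\<omega> ^ N = -1" "cmod \<omega> = 1"
      by (simp_all add: \<omega>_def)
    define h where "h z = (1/2) *\<^sub>R (g z + g (\<omega> * z))" for z
    have h: "h z * (1 - sc (z ^ 2 ^ Suc n) (c ^ 2 ^ Suc n)) = 1 \<and> (1 - sc (z ^ 2 ^ Suc n) (c ^ 2 ^ Suc n)) * h z = 1" for z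
    proof -
      define x where "x = sc (z ^ N) (c ^ N)"
      have p: "sc (z ^ 2 ^ Suc n) (c ^ 2 ^ Suc n) = x * x"
        by (simp add: x_def N_def sc_mult_left sc_mult_right sc_sc power_add[symmetric] mult_2)
      have m: "sc ((\<omega> * z) ^ N) (c ^ N) = - x"
        by (simp add: power_mult_distrib \<omega> x_def sc_minus_left)
      have 1: "g z * (1 - x) = 1" "(1 - x) * g z = 1" using g[of z] by (simp_all add: x_def)
      have 2: "g (\<omega> * z) * (1 + x) = 1" "(1 + x) * g (\<omega> * z) = 1" using g[of "\<omega> * z"] by (simp_all add: m)
      have q: "1 - x * x = (1 - x) * (1 + x)" "1 - x * x = (1 + x) * (1 - x)" by (simp_all add: algebra_simps)
      have "g z * (1 - x * x) = 1 + x" "g (\<omega> * z) * (1 - x * x) = 1 - x"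
        by (metis q 1 2 mult.assoc mult_1_left)+
      moreover have "(1 - x * x) * g z = 1 + x" "(1 - x * x) * g (\<omega> * z) = 1 - x"
        by (metis q 1 2 mult.assoc mult_1_right)+
      ultimately show ?thesis
        unfolding p h_def by (simp add: distrib_left distrib_right scaleR_2[symmetric])
    qed
    have "norm (h z - h w) \<le> K * cmod (z - w)" if "cmod z \<le> R" "cmod w \<le> R" for z w
    proof -
      have "h z - h w = (1/2) *\<^sub>R ((g z - g w) + (g (\<omega> * z) - g (\<omega> * w)))"
        by (simp add: h_def scaleR_diff_right[symmetric])
      hence "norm (h z - h w) \<le> (norm (g z - g w) + norm (g (\<omega> * z) - g (\<omega> * w))) / 2"
        using norm_triangle_ineq[of "g z - g w" "g (\<omega> * z) - g (\<omega> * w)"] by simp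
      moreover have "norm (g z - g w) \<le> K * cmod (z - w)" using gl that by blast
      moreover have "norm (g (\<omega> * z) - g (\<omega> * w)) \<le> K * cmod (\<omega> * z - \<omega> * w)"
        using that by (intro gl) (simp_all add: norm_mult \<omega>)
      moreover have "cmod (\<omega> * z - \<omega> * w) = cmod (z - w)"
        by (simp add: right_diff_distrib[symmetric] norm_mult \<omega>)
      ultimately show ?thesis by simp
    qed
    thus ?case using h by (intro exI[of _ h]) blast
  qed
  thus ?thesis using K by blast
qed

text \<open>Continuation in the radius. If \<open>T r\<close> holds, the inverse \<open>g\<close> is
  near \<open>1\<close> at \<open>r\<close>; its Lipschitz constant, the same for all
  \<open>n\<close>, keeps it near \<open>1\<close> at \<open>r + \<delta>\<close>. So the scaled
  powers stay bounded there and tend to 0 at \<open>r + \<delta> / 2\<close>. The step length is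
  fixed, and finitely many steps reach \<open>r0\<close>.\<close>

lemma quasinilpotent:
  assumes inv: "\<And>z. invertible_el (1 - sc z c)" and r0: "r0 > 0"
  shows "(\<lambda>n. r0 ^ 2 ^ n * norm (c ^ 2 ^ n)) \<longlonglongrightarrow> 0"
proof -
  define T where "T r \<longleftrightarrow> (\<lambda>n. r ^ 2 ^ n * norm (c ^ 2 ^ n)) \<longlonglongrightarrow> 0" for r :: real
  obtain K where K: "K > 0" and Kg: "\<And>n. \<exists>g. (\<forall>z. g z * (1 - sc (z ^ 2 ^ n) (c ^ 2 ^ n)) = 1 \<and> (1 - sc (z ^ 2 ^ n) (c ^ 2 ^ n)) * g z = 1) \<and>
     (\<forall>z w. cmod z \<le> 2 * r0 \<longrightarrow> cmod w \<le> 2 * r0 \<longrightarrow> norm (g z - g w) \<le> K * cmod (z - w))"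
    using resolvent_power_lipschitz[OF inv, where R = "2 * r0"] by blast
  have step: "T (r + \<delta> / 2)" if T: "T r" and d: "\<delta> > 0" "K * \<delta> \<le> 1 / 4" "r \<ge> 0" "r + \<delta> \<le> 2 * r0" for r \<delta>
  proof -
    define r' where "r' = r + \<delta>"
    have "\<forall>\<^sub>F n in sequentially. r ^ 2 ^ n * norm (c ^ 2 ^ n) < 1 / 5"
      using T unfolding T_def by (rule order_tendstoD) simp
    hence ev: "\<forall>\<^sub>F n in sequentially. r' ^ 2 ^ n * norm (c ^ 2 ^ n) \<le> 1"
    proof eventually_elim
      case (elim n)
      obtain g where g: "\<And>z. g z * (1 - sc (z ^ 2 ^ n) (c ^ 2 ^ n)) = 1"
        and gl: "\<And>z w. cmod z \<le> 2 * r0 \<Longrightarrow> cmod w \<le> 2 * r0 \<Longrightarrow> norm (g z - g w) \<le> K * cmod (z - w)"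
        using Kg[of n] by blast
      define x where "x = r ^ 2 ^ n *\<^sub>R (c ^ 2 ^ n)"
      define y where "y = r' ^ 2 ^ n *\<^sub>R (c ^ 2 ^ n)"
      define u where "u = g (of_real r)"
      define v where "v = g (of_real r')"
      have "u * (1 - x) = 1" "v * (1 - y) = 1"
        using g[of "of_real r"] g[of "of_real r'"]
        by (simp_all add: u_def v_def x_def y_def sc_of_real flip: of_real_power)
      hence ux: "u - 1 = u * x" and vy: "v - 1 = v * y" by (simp_all add: algebra_simps)
      \<comment> \<open>The bound 1/5 yields \<open>norm (u - 1) \<le> 1 / 4\<close>; a Lipschitz
        error of 1/4 then leaves \<open>norm (v - 1) \<le> 1 / 2\<close>, just what gives
        \<open>norm y \<le> 1\<close>.\<close>
      have nx: "norm x \<le> 1 / 5" using elim d by (simp add: x_def)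
      have "norm (u - 1) \<le> norm u * norm x" by (simp add: ux norm_mult_ineq)
      also have "\<dots> \<le> (1 + norm (u - 1)) * (1 / 5)"
        using nx norm_triangle_ineq[of 1 "u - 1"] by (intro mult_mono) auto
      finally have u1: "norm (u - 1) \<le> 1 / 4" by simp
      have "norm (v - u) \<le> K * cmod (of_real r' - of_real r)"
        unfolding u_def v_def using d by (intro gl) (auto simp: r'_def simp flip: of_real_add)
      also have "cmod (of_real r' - of_real r) = \<delta>"
        using d by (simp add: r'_def flip: of_real_diff)
      finally have "norm (v - u) \<le> 1 / 4" using d by simp
      hence v1: "norm (v - 1) \<le> 1 / 2"
        using norm_triangle_ineq[of "v - u" "u - 1"] u1 by simp
      have "(v - 1) - (v - 1) * y = (v - 1) - v * y + y" by (simp add: algebra_simps)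
      hence "y = (v - 1) - (v - 1) * y" using vy by simp
      hence "norm y \<le> norm (v - 1) + norm ((v - 1) * y)"
        by (metis norm_triangle_ineq4)
      also have "norm ((v - 1) * y) \<le> norm (v - 1) * norm y" by (rule norm_mult_ineq)
      also have "norm (v - 1) + norm (v - 1) * norm y \<le> 1 / 2 + 1 / 2 * norm y"
        using v1 by (intro add_mono mult_right_mono) auto
      finally have "norm y \<le> 1" by simp
      thus ?case using d by (simp add: y_def r'_def)
    qed
    define q where "q = (r + \<delta> / 2) / r'"
    have r': "r' > 0" using d by (simp add: r'_def)
    have q: "0 \<le> q" "q < 1" using d by (simp_all add: q_def r'_def)
    have "(\<lambda>n. q ^ n) \<longlonglongrightarrow> 0" using q by (intro LIMSEQ_realpow_zero)
    moreover have "strict_mono (\<lambda>n::nat. (2::nat) ^ n)" by (simp add: strict_mono_def)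
    ultimately have lim: "(\<lambda>n. q ^ 2 ^ n) \<longlonglongrightarrow> 0"
      using LIMSEQ_subseq_LIMSEQ[of "\<lambda>n. q ^ n" 0 "\<lambda>n. 2 ^ n"] by (simp add: o_def)
    have "\<forall>\<^sub>F n in sequentially. norm ((r + \<delta> / 2) ^ 2 ^ n * norm (c ^ 2 ^ n)) \<le> q ^ 2 ^ n"
      using ev
    proof eventually_elim
      case (elim n)
      have "(r + \<delta> / 2) ^ 2 ^ n * norm (c ^ 2 ^ n) = q ^ 2 ^ n * (r' ^ 2 ^ n * norm (c ^ 2 ^ n))"
        using r' by (simp add: q_def power_divide)
      also have "\<dots> \<le> q ^ 2 ^ n" using elim q mult_left_le[of _ "q ^ 2 ^ n"] by simp
      finally show ?case using d by simp
    qed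
    thus ?thesis unfolding T_def using lim by (rule Lim_null_comparison)
  qed
  \<comment> \<open>Beyond \<open>8 * K * r0\<close>, the length
    \<open>\<delta> = 2 * r0 / j\<close> satisfies \<open>K * \<delta> \<le> 1 / 4\<close>, and
    \<open>j\<close> half steps end exactly at \<open>r0\<close>.\<close>
  obtain j :: nat where j: "8 * K * r0 < real j" using reals_Archimedean2 by blast
  have j0: "real j > 0" using j K r0 by (meson mult_pos_pos zero_less_numeral less_trans)
  define \<delta> where "\<delta> = 2 * r0 / real j"
  have j1: "real j \<ge> 1" using j0 by simp
  have d: "\<delta> > 0" "K * \<delta> \<le> 1 / 4" using j j0 r0 by (simp_all add: \<delta>_def field_simps)
  have dr: "\<delta> / 2 \<le> r0" using j1 r0 by (simp add: \<delta>_def field_simps)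
  have "k \<le> j \<Longrightarrow> T (real k * (\<delta> / 2))" for k
  proof (induction k)
    case 0
    show ?case by (simp add: T_def power_0_left)
  next
    case (Suc k)
    have "real k * (\<delta> / 2) \<le> real j * (\<delta> / 2) - \<delta> / 2"
      using Suc.prems d mult_right_mono[of "real (Suc k)" "real j" "\<delta> / 2"] by (simp add: algebra_simps)
    also have "\<dots> = r0 - \<delta> / 2" using j0 by (simp add: \<delta>_def)
    finally have "real k * (\<delta> / 2) + \<delta> \<le> 2 * r0" using dr by simp
    hence "T (real k * (\<delta> / 2) + \<delta> / 2)" using Suc d by (intro step) auto
    thus ?case by (simp add: algebra_simps add_divide_distrib)
  qed
  from this[of j] have "T (real j * (\<delta> / 2))" by simp
  moreover have "real j * (\<delta> / 2) = r0" using j0 by (simp add: \<delta>_def)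
  ultimately show ?thesis by (simp add: T_def)
qed

text \<open>Normality gives \<open>y ^ n = st c ^ n * c ^ n\<close>, so
  \<open>norm y ^ 2 ^ n\<close> is at most the square of \<open>norm (c ^ 2 ^ n)\<close>, which
  decays faster than any geometric rate. The choice of \<open>r\<close> turns this into
  \<open>2 ^ 2 ^ n \<le> 1\<close>.\<close>

lemma normal_quasinilpotent_eq_0:
  assumes inv: "\<And>z. invertible_el (1 - sc z c)" and n: "st c * c = c * st c"
  shows "c = 0"
proof (rule ccontr)
  assume "c \<noteq> 0"
  define y where "y = st c * c"
  have y: "norm y > 0" using \<open>c \<noteq> 0\<close> by (simp add: y_def norm_st_mult)
  have yn: "y ^ n = st c ^ n * c ^ n" for n
    unfolding y_def using n by (rule power_mult_commuting)
  define r where "r = sqrt (2 / norm y)"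
  have r: "r > 0" "r\<^sup>2 * norm y = 2" using y by (simp_all add: r_def)
  have "\<forall>\<^sub>F n in sequentially. r ^ 2 ^ n * norm (c ^ 2 ^ n) < 1"
    using quasinilpotent[OF inv r(1)] by (rule order_tendstoD) simp
  then obtain n where n: "r ^ 2 ^ n * norm (c ^ 2 ^ n) < 1"
    by (auto simp: eventually_sequentially)
  have "2 ^ 2 ^ n = (r ^ 2 ^ n)\<^sup>2 * norm y ^ 2 ^ n"
    using r(2) by (metis power_mult power_mult_distrib mult.commute)
  also have "norm y ^ 2 ^ n = norm (y ^ 2 ^ n)"
    by (rule norm_power_self_adjoint[symmetric]) (simp add: y_def st_mult st_st)
  also have "\<dots> \<le> norm (c ^ 2 ^ n) * norm (c ^ 2 ^ n)"
    using norm_mult_ineq[of "st c ^ 2 ^ n" "c ^ 2 ^ n"] by (simp add: yn norm_st flip: st_power)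
  hence "(r ^ 2 ^ n)\<^sup>2 * norm (y ^ 2 ^ n) \<le> (r ^ 2 ^ n)\<^sup>2 * (norm (c ^ 2 ^ n) * norm (c ^ 2 ^ n))"
    by (intro mult_left_mono) auto
  also have "\<dots> = (r ^ 2 ^ n * norm (c ^ 2 ^ n))\<^sup>2" by (simp add: power2_eq_square)
  also have "\<dots> \<le> 1" using n r by (intro power_le_one) auto
  finally have "(2::real) ^ 2 ^ n \<le> 1" .
  moreover have "(2::real) ^ 2 ^ n > 1" by (rule one_less_power) simp_all
  ultimately show False by simp
qed

section \<open>Polynomials in an element and spectral mapping\<close>

definition peval :: "'a \<Rightarrow> complex poly \<Rightarrow> 'a" where
  "peval b p = fold_coeffs (\<lambda>z a. sc z 1 + b * a) p 0"

lemma peval_0 [simp]: "peval b 0 = 0"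
  by (simp add: peval_def)

lemma peval_pCons [simp]: "peval b (pCons z p) = sc z 1 + b * peval b p"
  by (cases "z = 0 \<and> p = 0") (auto simp: peval_def)

lemma peval_add: "peval b (p + q) = peval b p + peval b q"
proof (induction p arbitrary: q)
  case (pCons z p)
  show ?case
    by (cases q) (simp add: pCons sc_add_left distrib_left)
qed simp

lemma peval_smult: "peval b (smult z p) = sc z (peval b p)"
  by (induction p) (simp_all add: sc_add_right sc_sc sc_mult_right)

lemma peval_mult: "peval b (p * q) = peval b p * peval b q"
proof (induction p)
  case (pCons z p)
  have "sc z 1 * peval b q = sc z (peval b q)" by (simp add: sc_mult_left)
  thus ?case by (simp add: pCons peval_add peval_smult distrib_right mult.assoc)
qed simp

lemma peval_1 [simp]: "peval b 1 = 1"
  by (simp add: one_pCons)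

lemma peval_sum: "peval b (\<Sum>i\<in>I. f i) = (\<Sum>i\<in>I. peval b (f i))"
  by (induction I rule: infinite_finite_induct) (simp_all add: peval_add)

lemma peval_linear: "peval b [:- z, 1:] = b - sc z 1"
  by (simp add: sc_minus_left)

lemma peval_commute: "x * b = b * x \<Longrightarrow> x * peval b p = peval b p * x"
proof (induction p)
  case (pCons z p)
  hence "x * (b * peval b p) = b * peval b p * x" by (metis mult.assoc)
  thus ?case by (simp add: distrib_left distrib_right sc_mult_left sc_mult_right)
qed simp

lemma peval_prod_mset_invertible:
  "(\<And>r. r \<in># A \<Longrightarrow> invertible_el (b - sc r 1)) \<Longrightarrow> invertible_el (peval b (\<Prod>r\<in>#A. [:- r, 1:]))"
proof (induction A)
  case empty
  thus ?case by (auto simp: invertible_el_def)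
next
  case (add r A)
  thus ?case by (simp add: peval_mult peval_linear invertible_el_mult del: peval_pCons mult_pCons_left)
qed

text \<open>Half of the spectral mapping theorem: \<open>p - z\<close> splits into linear factors,
  each invertible at \<open>b\<close>. Positive degree ensures that \<open>p - z\<close> is not the
  zero polynomial.\<close>

lemma peval_minus_const_invertible:
  assumes "\<And>r. poly p r = z \<Longrightarrow> invertible_el (b - sc r 1)" and "degree p > 0"
  shows "invertible_el (peval b p - sc z 1)"
proof -
  define q where "q = p - [:z:]"
  have q0: "q \<noteq> 0" using assms(2) by (auto simp: q_def)
  obtain A where A: "q = smult (lead_coeff q) (\<Prod>r\<in>#A. [:- r, 1:])"
    using alg_closed_imp_factorization[OF q0] by blast
  have l: "lead_coeff q \<noteq> 0" using q0 by simp
  have "invertible_el (b - sc r 1)" if "r \<in># A" for r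
  proof (rule assms(1))
    have "poly q r = 0"
      by (subst A) (use that in \<open>simp add: poly_prod_mset prod_mset_zero_iff\<close>)
    thus "poly p r = z" by (simp add: q_def)
  qed
  hence "invertible_el (peval b (\<Prod>r\<in>#A. [:- r, 1:]))" by (rule peval_prod_mset_invertible)
  then obtain d where d: "peval b (\<Prod>r\<in>#A. [:- r, 1:]) * d = 1" "d * peval b (\<Prod>r\<in>#A. [:- r, 1:]) = 1"
    by (auto simp: invertible_el_def)
  have "peval b q = sc (lead_coeff q) (peval b (\<Prod>r\<in>#A. [:- r, 1:]))"
    by (subst A) (simp only: peval_smult)
  hence "peval b q * sc (1 / lead_coeff q) d = 1" "sc (1 / lead_coeff q) d * peval b q = 1"
    using l d by (simp_all add: sc_mult_left sc_mult_right sc_sc)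
  moreover have "peval b p = peval b q + sc z 1"
  proof -
    have "p = q + [:z:]" by (simp add: q_def)
    thus ?thesis by (metis peval_add peval_pCons peval_0 mult_zero_right add_0_right)
  qed
  ultimately show ?thesis unfolding invertible_el_def by auto
qed

text \<open>The polynomial vanishes on \<open>C\<close>, so by spectral mapping its value
  \<open>c\<close> at \<open>b\<close> has no nonzero spectral value. Since \<open>C\<close> may
  contain non-real points, \<open>c\<close> is not visibly self-adjoint; but \<open>st c\<close>
  commutes with \<open>b\<close>, hence with \<open>c\<close>, and normality suffices.\<close>

lemma finite_spectrum_annihilator:
  assumes b: "st b = b" and C: "finite C" "spec sc b \<subseteq> C" "C \<noteq> {}"
  shows "peval b (\<Prod>z\<in>C. [:- z, 1:]) = 0"
proof -
  define p :: "complex poly" where "p = (\<Prod>z\<in>C. [:- z, 1:])"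
  define c where "c = peval b p"
  have "degree p = (\<Sum>z\<in>C. degree [:- z, 1:])"
    unfolding p_def by (rule degree_prod_eq_sum_degree) simp
  hence deg: "degree p > 0" using C by (simp add: card_gt_0_iff)
  have inv: "invertible_el (1 - sc z c)" for z
  proof (cases "z = 0")
    case True
    thus ?thesis by (auto simp: invertible_el_def)
  next
    case False
    have "invertible_el (c - sc (1 / z) 1)"
      unfolding c_def
    proof (rule peval_minus_const_invertible[OF _ deg])
      fix r assume "poly p r = 1 / z"
      hence "poly p r \<noteq> 0" using False by simp
      hence "r \<notin> C" using C by (auto simp: p_def poly_prod)
      thus "invertible_el (b - sc r 1)" using C by (auto simp: spec_def)
    qed
    then obtain d where d: "(c - sc (1 / z) 1) * d = 1" "d * (c - sc (1 / z) 1) = 1"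
      by (auto simp: invertible_el_def)
    have "1 - sc z c = sc (- z) (c - sc (1 / z) 1)"
      using False by (simp add: sc_diff_right sc_minus_left sc_sc)
    hence "(1 - sc z c) * sc (- 1 / z) d = 1" "sc (- 1 / z) d * (1 - sc z c) = 1"
      using False d by (simp_all add: sc_mult_left sc_mult_right sc_sc)
    thus ?thesis unfolding invertible_el_def by blast
  qed
  have "b * c = c * b" unfolding c_def by (rule peval_commute) simp
  hence "st c * b = b * st c" by (metis b st_mult)
  hence "st c * c = c * st c" unfolding c_def by (rule peval_commute)
  thus ?thesis using normal_quasinilpotent_eq_0[OF inv] by (simp add: c_def p_def)
qed

section \<open>Finite spectral resolutions and their calculus\<close>

definition resolution :: "real set \<Rightarrow> (real \<Rightarrow> 'a) \<Rightarrow> bool" where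
  "resolution L e \<longleftrightarrow> finite L \<and> (\<forall>l\<in>L. e l * e l = e l \<and> st (e l) = e l \<and> e l \<noteq> 0) \<and>
     (\<forall>l\<in>L. \<forall>m\<in>L. l \<noteq> m \<longrightarrow> e l * e m = 0) \<and> (\<Sum>l\<in>L. e l) = 1"

text \<open>The projections are the Lagrange interpolation polynomials \<open>q z\<close> evaluated
  at \<open>b\<close>; the annihilating polynomial makes them eigenprojections. For non-real
  \<open>z\<close>, comparing eigenvalues gives \<open>st (E z) * E z = 0\<close>, so
  \<open>E z = 0\<close>.\<close>

lemma spectral_resolution:
  assumes b: "st b = b" and fin: "finite (spec sc b)"
  obtains L e where "resolution L e" "b = (\<Sum>l\<in>L. l *\<^sub>R e l)"
proof -
  \<comment> \<open>Adjoining 0 makes \<open>C\<close> nonempty whatever the spectrum is; points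
    with \<open>E z = 0\<close> are dropped in \<open>C'\<close>.\<close>
  define C where "C = insert 0 (spec sc b)"
  have C: "finite C" "spec sc b \<subseteq> C" "C \<noteq> {}" using fin by (auto simp: C_def)
  define k where "k z = (\<Prod>w\<in>C - {z}. z - w)" for z
  define q where "q z = smult (1 / k z) (\<Prod>w\<in>C - {z}. [:- w, 1:])" for z
  define E where "E z = peval b (q z)" for z
  have k0: "k z \<noteq> 0" for z using C by (auto simp: k_def)
  have qv: "poly (q z) w = (if w = z then 1 else 0)" if "z \<in> C" "w \<in> C" for z w
  proof (cases "w = z")
    case True
    thus ?thesis using k0[of z] by (simp add: q_def k_def poly_prod)
  next
    case False
    hence "(\<Prod>v\<in>C - {z}. poly [:- v, 1:] w) = 0"
      using that C by (intro prod_zero) auto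
    thus ?thesis using False by (simp add: q_def poly_prod)
  qed
  have bE: "b * E z = sc z (E z)" if "z \<in> C" for z
  proof -
    have "[:- z, 1:] * q z = smult (1 / k z) ([:- z, 1:] * (\<Prod>w\<in>C - {z}. [:- w, 1:]))"
      by (simp only: q_def mult_smult_right)
    also have "\<dots> = smult (1 / k z) (\<Prod>w\<in>C. [:- w, 1:])"
      using that C by (subst (2) prod.remove[of _ z]) auto
    finally have "(b - sc z 1) * E z = 0"
      unfolding E_def peval_linear[symmetric] peval_mult[symmetric]
      by (simp only: peval_smult finite_spectrum_annihilator[OF b C] sc_0_right)
    thus ?thesis by (simp add: algebra_simps sc_mult_left)
  qed
  have pE: "peval b p * E z = sc (poly p z) (E z)" if "z \<in> C" for p z
  proof (induction p)
    case (pCons a p)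
    thus ?case
      using bE[OF that] by (simp add: distrib_right sc_add_left sc_mult_left sc_mult_right mult.assoc sc_sc mult.commute)
  qed simp
  have EE: "E w * E z = (if w = z then E z else 0)" if "w \<in> C" "z \<in> C" for w z
    using pE[OF that(2), of "q w"] qv[OF that] by (auto simp: E_def)
  have degq: "degree (q z) < card C" if "z \<in> C" for z
  proof -
    have "degree (q z) \<le> degree (\<Prod>w\<in>C - {z}. [:- w, 1:])" by (simp add: q_def)
    also have "\<dots> = (\<Sum>w\<in>C - {z}. degree [:- w, 1:])" by (rule degree_prod_eq_sum_degree) simp
    also have "\<dots> = card (C - {z})" by simp
    also have "\<dots> < card C" using that C by (intro psubset_card_mono) auto
    finally show ?thesis .
  qed
  have cC: "card C > 0" using C by (simp add: card_gt_0_iff)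
  have "(\<Sum>z\<in>C. q z) = 1"
  proof (rule poly_eqI_degree[where A = C])
    show "poly (\<Sum>z\<in>C. q z) w = poly 1 w" if "w \<in> C" for w
      using that C qv by (simp add: poly_sum)
    show "degree (\<Sum>z\<in>C. q z) < card C" using degq cC by (intro degree_sum_less)
  qed (use cC in simp)
  hence sumE: "(\<Sum>z\<in>C. E z) = 1"
    using peval_sum[of b q C] by (simp add: E_def)
  have stb: "st (E w) * b = sc (cnj w) (st (E w))" if "w \<in> C" for w
    using arg_cong[OF bE[OF that], of st] by (simp add: st_mult b st_sc)
  have ortho: "st (E w) * E z = 0" if "w \<in> C" "z \<in> C" "z \<noteq> cnj w" for w z
  proof -
    have "sc z (st (E w) * E z) = st (E w) * (b * E z)"
      using bE[OF that(2)] by (simp add: sc_mult_right)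
    also have "\<dots> = sc (cnj w) (st (E w) * E z)"
      using stb[OF that(1)] by (simp add: sc_mult_left flip: mult.assoc)
    finally have "sc (z - cnj w) (st (E w) * E z) = 0" by (simp add: sc_diff_left)
    thus ?thesis using that(3) by (simp add: sc_eq_0_iff)
  qed
  have real: "z = complex_of_real (Re z)" if "z \<in> C" "E z \<noteq> 0" for z
  proof (rule ccontr)
    assume "z \<noteq> complex_of_real (Re z)"
    hence "z \<noteq> cnj z" by (auto simp: complex_eq_iff)
    hence "st (E z) * E z = 0" using ortho that by blast
    thus False using st_mult_eq_0 that by blast
  qed
  have sa: "st (E z) = E z" if "z \<in> C" "E z \<noteq> 0" for z
  proof -
    have rz: "cnj z = z" using real[OF that] by (metis complex_cnj_complex_of_real)
    have "st (E z) = st (E z) * (\<Sum>w\<in>C. E w)" by (simp add: sumE)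
    also have "\<dots> = (\<Sum>w\<in>C. st (E z) * E w)" by (simp add: sum_distrib_left)
    also have "\<dots> = (\<Sum>w\<in>C. if w = z then st (E z) * E z else 0)"
      using ortho that rz by (intro sum.cong) auto
    also have "\<dots> = st (E z) * E z" using that C by simp
    finally have *: "st (E z) = st (E z) * E z" .
    have "E z = st (st (E z) * E z)" using * by (metis st_st)
    also have "\<dots> = st (E z) * E z" by (simp add: st_mult st_st)
    finally show ?thesis using * by simp
  qed
  define C' where "C' = {z \<in> C. E z \<noteq> 0}"
  define L where "L = Re ` C'"
  define e where "e l = E (complex_of_real l)" for l
  have r: "complex_of_real (Re z) = z" if "z \<in> C'" for z
    using real[of z] that by (auto simp: C'_def)
  have inj: "inj_on Re C'" by (rule inj_on_inverseI[where g = complex_of_real]) (rule r)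
  have LC: "complex_of_real l \<in> C'" if "l \<in> L" for l
    using that r by (auto simp: L_def)
  have sumL: "(\<Sum>l\<in>L. f l (e l)) = (\<Sum>z\<in>C'. f (Re z) (E z))" for f :: "real \<Rightarrow> 'a \<Rightarrow> 'a"
    unfolding L_def using inj r by (simp add: sum.reindex e_def)
  have C'C: "(\<Sum>z\<in>C'. E z) = (\<Sum>z\<in>C. E z)"
    using C by (intro sum.mono_neutral_left) (auto simp: C'_def)
  have "resolution L e"
    unfolding resolution_def
  proof (intro conjI ballI impI)
    show "finite L" using C by (simp add: L_def C'_def)
    show "(\<Sum>l\<in>L. e l) = 1" using sumL[of "\<lambda>_ x. x"] C'C sumE by simp
  next
    fix l assume "l \<in> L"
    thus "e l * e l = e l" "st (e l) = e l" "e l \<noteq> 0"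
      using LC[of l] EE sa by (auto simp: e_def C'_def)
  next
    fix l m assume "l \<in> L" "m \<in> L" "l \<noteq> m"
    thus "e l * e m = 0" using LC[of l] LC[of m] EE by (auto simp: e_def C'_def)
  qed
  moreover have "b = (\<Sum>l\<in>L. l *\<^sub>R e l)"
  proof -
    have "b = b * (\<Sum>z\<in>C'. E z)" by (simp add: C'C sumE)
    also have "\<dots> = (\<Sum>z\<in>C'. sc z (E z))"
      unfolding sum_distrib_left by (intro sum.cong) (auto simp: bE C'_def)
    also have "\<dots> = (\<Sum>z\<in>C'. Re z *\<^sub>R E z)"
      using r by (intro sum.cong) (auto simp flip: sc_of_real)
    also have "\<dots> = (\<Sum>l\<in>L. l *\<^sub>R e l)" by (simp add: sumL[of "\<lambda>l x. l *\<^sub>R x"])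
    finally show ?thesis .
  qed
  ultimately show ?thesis using that by blast
qed

definition fcalc :: "real set \<Rightarrow> (real \<Rightarrow> 'a) \<Rightarrow> (real \<Rightarrow> real) \<Rightarrow> 'a" where
  "fcalc L e \<phi> = (\<Sum>l\<in>L. \<phi> l *\<^sub>R e l)"

context
  fixes L e assumes res: "resolution L e"
begin

lemma fcalc_mult: "fcalc L e \<phi> * fcalc L e \<psi> = fcalc L e (\<lambda>x. \<phi> x * \<psi> x)"
proof -
  have "fcalc L e \<phi> * fcalc L e \<psi> = (\<Sum>l\<in>L. \<Sum>m\<in>L. (\<phi> l * \<psi> m) *\<^sub>R (e l * e m))"
    by (simp add: fcalc_def sum_product mult.commute)
  also have "\<dots> = (\<Sum>l\<in>L. \<Sum>m\<in>L. if m = l then (\<phi> l * \<psi> l) *\<^sub>R e l else 0)"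
    using res by (intro sum.cong refl) (auto simp: resolution_def)
  also have "\<dots> = fcalc L e (\<lambda>x. \<phi> x * \<psi> x)"
    using res by (simp add: fcalc_def resolution_def)
  finally show ?thesis .
qed

lemma fcalc_diff: "fcalc L e \<phi> - fcalc L e \<psi> = fcalc L e (\<lambda>x. \<phi> x - \<psi> x)"
  by (simp add: fcalc_def sum_subtractf scaleR_diff_left)

lemma fcalc_const: "fcalc L e (\<lambda>x. r) = r *\<^sub>R 1"
  using res by (simp add: fcalc_def resolution_def flip: scaleR_sum_right)

lemma fcalc_power: "fcalc L e \<phi> ^ n = fcalc L e (\<lambda>x. \<phi> x ^ n)"
  using fcalc_const[of 1] by (induction n) (simp_all add: fcalc_mult)

lemma st_fcalc: "st (fcalc L e \<phi>) = fcalc L e \<phi>"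
  using res by (simp add: fcalc_def st_sum st_scaleR resolution_def cong: sum.cong)

text \<open>The triangle inequality alone loses a factor \<open>card L\<close>. Applied to
  \<open>x ^ 2 ^ n\<close>, whose norm is \<open>norm x ^ 2 ^ n\<close>, the loss stays fixed while
  the powers grow.\<close>

lemma norm_fcalc_le:
  assumes "\<And>l. l \<in> L \<Longrightarrow> \<bar>\<phi> l\<bar> \<le> M" and M: "M \<ge> 0"
  shows "norm (fcalc L e \<phi>) \<le> M"
proof (rule ccontr)
  define x where "x = fcalc L e \<phi>"
  assume "\<not> norm (fcalc L e \<phi>) \<le> M"
  hence x: "norm x > M" by (simp add: x_def)
  define N where "N = (norm x + M) / 2"
  have N: "M \<le> N" "N > 0" "norm x / N > 1" using x M by (auto simp: N_def field_simps)
  obtain n where n: "real (card L) < (norm x / N) ^ n"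
    using real_arch_pow[OF N(3)] by blast
  have "n \<le> 2 ^ n" by simp
  hence "(norm x / N) ^ n \<le> (norm x / N) ^ 2 ^ n"
    using N by (intro power_increasing) auto
  hence n2: "real (card L) < (norm x / N) ^ 2 ^ n" using n by simp
  have "norm x ^ 2 ^ n = norm (x ^ 2 ^ n)"
    unfolding x_def by (rule norm_power_self_adjoint[OF st_fcalc, symmetric])
  also have "\<dots> \<le> (\<Sum>l\<in>L. norm ((\<phi> l ^ 2 ^ n) *\<^sub>R e l))"
    unfolding x_def fcalc_power by (simp only: fcalc_def norm_sum)
  also have "\<dots> \<le> (\<Sum>l\<in>L. N ^ 2 ^ n)"
  proof (rule sum_mono)
    fix l assume l: "l \<in> L"
    hence "norm (e l) = 1" using res by (intro norm_projection) (auto simp: resolution_def)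
    moreover have "\<bar>\<phi> l\<bar> ^ 2 ^ n \<le> N ^ 2 ^ n"
      using assms(1)[OF l] N by (intro power_mono) auto
    ultimately show "norm ((\<phi> l ^ 2 ^ n) *\<^sub>R e l) \<le> N ^ 2 ^ n" by (simp add: power_abs)
  qed
  also have "\<dots> = real (card L) * N ^ 2 ^ n" by simp
  finally have "(norm x / N) ^ 2 ^ n \<le> real (card L)"
    using N by (simp add: power_divide field_simps)
  thus False using n2 by simp
qed

lemma fcalc_eigen: "l \<in> L \<Longrightarrow> fcalc L e \<phi> * e l = \<phi> l *\<^sub>R e l"
proof -
  assume l: "l \<in> L"
  have "fcalc L e \<phi> * e l = (\<Sum>m\<in>L. if m = l then \<phi> l *\<^sub>R e l else 0)"
    unfolding fcalc_def sum_distrib_right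
    using res l by (intro sum.cong) (auto simp: resolution_def)
  thus ?thesis using res l by (simp add: resolution_def)
qed

lemma resolution_bound:
  assumes l: "l \<in> L"
  shows "\<bar>l\<bar> \<le> norm (fcalc L e (\<lambda>x. x))"
proof -
  have "norm (e l) = 1" using res l by (intro norm_projection) (auto simp: resolution_def)
  thus ?thesis
    using norm_mult_ineq[of "fcalc L e (\<lambda>x. x)" "e l"] by (simp add: fcalc_eigen[OF l])
qed

end

end
section \<open>Positivity and real rank zero\<close>

lemma invertible_el_near_scaleR:
  fixes x :: "'a::{banach,real_normed_algebra_1}"
  assumes "norm (M *\<^sub>R 1 - x) < M"
  shows "invertible_el x"
proof -
  have M: "M > 0" using assms norm_ge_zero by (rule le_less_trans[rotated])
  have "1 - (1 / M) *\<^sub>R x = (1 / M) *\<^sub>R (M *\<^sub>R 1 - x)"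
    using M by (simp add: scaleR_diff_right)
  hence "norm (1 - (1 / M) *\<^sub>R x) < 1" using M assms by simp
  then obtain d where "(1 / M) *\<^sub>R x * d = 1" "d * ((1 / M) *\<^sub>R x) = 1"
    using invertible_el_near_one unfolding invertible_el_def by blast
  hence "x * ((1 / M) *\<^sub>R d) = 1" "((1 / M) *\<^sub>R d) * x = 1" by simp_all
  thus ?thesis unfolding invertible_el_def by blast
qed

text \<open>For self-adjoint \<open>x\<close> this norm condition says that the spectrum is nonnegative; unlike the
  latter it is visibly stable under sums.\<close>

definition norm_positive :: "'a::real_normed_algebra_1 \<Rightarrow> bool" where
  "norm_positive x \<longleftrightarrow> (\<exists>M. norm (M *\<^sub>R 1 - x) \<le> M)"

lemma norm_positive_add:
  assumes "norm_positive x" "norm_positive y"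
  shows "norm_positive (x + y)"
proof -
  obtain M N where "norm (M *\<^sub>R 1 - x) \<le> M" "norm (N *\<^sub>R 1 - y) \<le> N"
    using assms by (auto simp: norm_positive_def)
  hence "norm ((M *\<^sub>R 1 - x) + (N *\<^sub>R 1 - y)) \<le> M + N"
    by (meson add_mono norm_triangle_ineq order_trans)
  thus ?thesis unfolding norm_positive_def
    by (intro exI[of _ "M + N"]) (simp add: algebra_simps)
qed

lemma norm_positive_shift: "norm x \<le> r \<Longrightarrow> norm_positive (r *\<^sub>R 1 + x)"
  unfolding norm_positive_def by (intro exI[of _ r]) simp

text \<open>In \<open>M + k = (M - t) + (k + t)\<close> the first summand accounts for at most
  \<open>M * norm v\<close>.\<close>

lemma norm_positive_expanding:
  assumes "norm_positive t"
  shows "k * norm v \<le> norm ((k *\<^sub>R 1 + t) * v)"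
proof -
  obtain M where M: "norm (M *\<^sub>R 1 - t) \<le> M" using assms by (auto simp: norm_positive_def)
  have "(M + k) *\<^sub>R v = (M *\<^sub>R 1 - t) * v + (k *\<^sub>R 1 + t) * v" by (simp add: algebra_simps)
  hence "norm ((M + k) *\<^sub>R v) \<le> norm ((M *\<^sub>R 1 - t) * v) + norm ((k *\<^sub>R 1 + t) * v)"
    by (metis norm_triangle_ineq)
  also have "norm ((M *\<^sub>R 1 - t) * v) \<le> M * norm v"
    by (meson M mult_right_mono norm_ge_zero norm_mult_ineq order_trans)
  finally have "\<bar>M + k\<bar> * norm v \<le> M * norm v + norm ((k *\<^sub>R 1 + t) * v)" by simp
  moreover have "(M + k) * norm v \<le> \<bar>M + k\<bar> * norm v" by (intro mult_right_mono) auto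
  ultimately show ?thesis by (simp add: distrib_right)
qed

context cstar
begin

lemma cartesian_decomposition:
  obtains R I where "st R = R" "st I = I" "a = R + sc \<i> I"
proof
  show "st ((1/2) *\<^sub>R (a + st a)) = (1/2) *\<^sub>R (a + st a)"
    by (simp add: st_scaleR st_add st_st add.commute)
  show "st (sc (- \<i> / 2) (a - st a)) = sc (- \<i> / 2) (a - st a)"
  proof -
    have "st (sc (- \<i> / 2) (a - st a)) = sc (\<i> / 2) (- (a - st a))"
      by (simp add: st_sc st_diff st_st)
    also have "\<dots> = sc (- \<i> / 2) (a - st a)"
      by (simp only: sc_minus_right sc_minus_left[symmetric] minus_divide_left)
    finally show ?thesis .
  qed
  have "sc \<i> (sc (- \<i> / 2) (a - st a)) = sc (of_real (1/2)) (a - st a)"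
    by (simp add: sc_sc)
  also have "\<dots> = (1/2) *\<^sub>R (a - st a)" by (rule sc_of_real)
  finally show "a = (1/2) *\<^sub>R (a + st a) + sc \<i> (sc (- \<i> / 2) (a - st a))"
    by (simp add: scaleR_right_diff_distrib scaleR_right_distrib flip: scaleR_add_left)
qed

lemma norm_positive_scaleR_projection:
  assumes "e * e = e" "st e = e" "r \<ge> 0"
  shows "norm_positive (r *\<^sub>R e)"
proof -
  have "norm (1 - e) \<le> 1"
  proof (cases "1 - e = 0")
    case False
    have "norm (1 - e) = 1"
      by (rule norm_projection[OF _ _ False]) (use assms in \<open>simp_all add: algebra_simps st_diff\<close>)
    thus ?thesis by simp
  qed simp
  hence "norm (r *\<^sub>R (1 - e)) \<le> r" using assms mult_left_le[of "norm (1 - e)" r] by simp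
  thus ?thesis unfolding norm_positive_def by (intro exI[of _ r]) (simp add: scaleR_diff_right)
qed

end

section \<open>Approximation by finite resolutions and the exchange property\<close>

locale cstar_rr0 = cstar +
  assumes rr0: "real_rank_zero sc st"
begin

lemma resolution_near:
  assumes "st a = a" "d > 0"
  obtains L e where "resolution L e" "norm (a - fcalc L e (\<lambda>x. x)) < d"
proof -
  have "a \<in> closure {b. st b = b \<and> finite (spec sc b)}"
    using rr0 assms by (auto simp: real_rank_zero_def)
  then obtain b where b: "st b = b" "finite (spec sc b)" "dist b a < d"
    using assms(2) unfolding closure_approachable by blast
  obtain L e where "resolution L e" "b = (\<Sum>l\<in>L. l *\<^sub>R e l)"
    using spectral_resolution[OF b(1,2)] .
  thus ?thesis using that[of L e] b by (simp add: fcalc_def dist_norm norm_minus_commute)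
qed

lemma resolution_sequence:
  assumes "st a = a"
  obtains L e where "\<And>n. resolution (L n) (e n)" "(\<lambda>n. fcalc (L n) (e n) (\<lambda>x. x)) \<longlonglongrightarrow> a"
proof -
  have "\<exists>L e. resolution L e \<and> norm (a - fcalc L e (\<lambda>x. x)) < inverse (real (Suc n))" for n
  proof -
    have "0 < inverse (real (Suc n))" by simp
    from resolution_near[OF assms this] show ?thesis by blast
  qed
  then obtain L e where Le: "\<And>n. resolution (L n) (e n)"
    "\<And>n. norm (a - fcalc (L n) (e n) (\<lambda>x. x)) < inverse (real (Suc n))"
    by metis
  have "(\<lambda>n. fcalc (L n) (e n) (\<lambda>x. x) - a) \<longlonglongrightarrow> 0"
  proof (rule Lim_null_comparison)
    show "\<forall>\<^sub>F n in sequentially. norm (fcalc (L n) (e n) (\<lambda>x. x) - a) \<le> inverse (real (Suc n))"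
      using Le(2) by (intro always_eventually allI) (simp add: norm_minus_commute less_imp_le)
  qed (rule LIMSEQ_inverse_real_of_nat)
  thus ?thesis using that[of L e] Le(1) by (simp add: LIM_zero_iff)
qed

text \<open>For an approximant \<open>s\<close> the eigenvalues of
  \<open>(norm s)\<^sup>2 - s * s\<close> lie between 0 and \<open>(norm s)\<^sup>2\<close>. This
  witness depends continuously on \<open>s\<close>, so the inequality survives the limit.\<close>

lemma norm_positive_square:
  assumes "st a = a"
  shows "norm_positive (a * a)"
proof -
  obtain L e where Le: "\<And>n. resolution (L n) (e n)" and lim: "(\<lambda>n. fcalc (L n) (e n) (\<lambda>x. x)) \<longlonglongrightarrow> a"
    using resolution_sequence[OF assms] by blast
  define s where "s n = fcalc (L n) (e n) (\<lambda>x. x)" for n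
  have s: "s \<longlonglongrightarrow> a" using lim by (simp add: s_def[abs_def])
  have "norm ((norm (s n))\<^sup>2 *\<^sub>R 1 - s n * s n) \<le> (norm (s n))\<^sup>2" for n
  proof -
    have "(norm (s n))\<^sup>2 *\<^sub>R 1 - s n * s n = fcalc (L n) (e n) (\<lambda>x. (norm (s n))\<^sup>2 - x * x)"
      unfolding fcalc_diff[OF Le, symmetric] fcalc_const[OF Le] fcalc_mult[OF Le, symmetric]
      by (simp add: s_def)
    moreover have "\<bar>(norm (s n))\<^sup>2 - l * l\<bar> \<le> (norm (s n))\<^sup>2" if "l \<in> L n" for l
    proof -
      have "l * l \<le> (norm (s n))\<^sup>2"
        using power_mono[OF resolution_bound[OF Le that], of 2] by (simp add: s_def power2_eq_square)
      thus ?thesis by (simp add: abs_le_iff)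
    qed
    ultimately show ?thesis using norm_fcalc_le[OF Le] by simp
  qed
  moreover have "(\<lambda>n. norm ((norm (s n))\<^sup>2 *\<^sub>R 1 - s n * s n)) \<longlonglongrightarrow> norm ((norm a)\<^sup>2 *\<^sub>R 1 - a * a)"
    by (intro tendsto_intros s)
  moreover have "(\<lambda>n. (norm (s n))\<^sup>2) \<longlonglongrightarrow> (norm a)\<^sup>2"
    by (intro tendsto_intros s)
  ultimately have "norm ((norm a)\<^sup>2 *\<^sub>R 1 - a * a) \<le> (norm a)\<^sup>2"
    by (intro LIMSEQ_le) auto
  thus ?thesis unfolding norm_positive_def by blast
qed

text \<open>Cutting \<open>b\<close> down to an eigenprojection for a very negative eigenvalue gives \<open>c\<close> with
  \<open>c c\<^sup>*\<close> close to a negative multiple of that projection; positivity of \<open>c\<^sup>* c + c c\<^sup>*\<close> then forces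
  \<open>c = 0\<close>.\<close>

lemma eigenvalue_lower_bound:
  assumes res: "resolution L e" and l: "l \<in> L"
    and d: "d = norm (b * st b - fcalc L e (\<lambda>x. x))"
  shows "- 3 * d \<le> l"
proof (rule ccontr)
  assume "\<not> - 3 * d \<le> l"
  hence neg: "l < - 3 * d" by simp
  have d0: "d \<ge> 0" by (simp add: d)
  have p: "e l * e l = e l" "st (e l) = e l" "e l \<noteq> 0"
    using res l by (auto simp: resolution_def)
  have n1: "norm (e l) = 1" using norm_projection p by blast
  define c where "c = e l * b"
  define w where "w = c * st c - l *\<^sub>R e l"
  have "w = e l * (b * st b - fcalc L e (\<lambda>x. x)) * e l"
    by (simp add: w_def c_def st_mult p algebra_simps fcalc_eigen[OF res l])
  hence "norm w \<le> norm (e l) * d * norm (e l)"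
    unfolding d by (simp only: norm_mult3_le)
  hence w: "norm w \<le> d" by (simp add: n1)
  obtain R I where RI: "st R = R" "st I = I" "c = R + sc \<i> I" by (rule cartesian_decomposition)
  have stc: "st c = R - sc \<i> I" using RI by (simp add: st_add st_sc sc_minus_left)
  have "st c * c + c * st c = (R * R + R * R) + (I * I + I * I)"
    unfolding stc unfolding RI(3)
    by (simp add: algebra_simps sc_mult_left sc_mult_right sc_sc sc_minus_left sc_add_right sc_diff_right)
  \<comment> \<open>The summands on the right are norm-positive one by one: squares of self-adjoint
    elements, an error of norm at most \<open>d\<close> shifted by \<open>d\<close>, and a
    projection times \<open>- l > 0\<close>.\<close>
  hence "d *\<^sub>R 1 + st c * c = ((R * R + R * R) + (I * I + I * I)) + ((d *\<^sub>R 1 + - w) + (- l) *\<^sub>R e l)"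
    by (simp add: w_def algebra_simps)
  moreover have "norm_positive ((R * R + R * R) + (I * I + I * I))"
    using RI by (intro norm_positive_add norm_positive_square)
  moreover have "norm_positive (d *\<^sub>R 1 + - w)"
    using w by (intro norm_positive_shift) simp
  moreover have "norm_positive ((- l) *\<^sub>R e l)"
    using p neg d0 by (intro norm_positive_scaleR_projection) auto
  ultimately have "norm_positive (d *\<^sub>R 1 + st c * c)"
    by (simp only: norm_positive_add)
  hence "(- l - d) * norm (st c) \<le> norm (((- l - d) *\<^sub>R 1 + (d *\<^sub>R 1 + st c * c)) * st c)"
    by (rule norm_positive_expanding)
  \<comment> \<open>The scalars cancel to \<open>- l\<close>, and \<open>st c\<close> absorbs
    \<open>e l\<close>, so only the small error \<open>w\<close> remains.\<close>
  also have "((- l - d) *\<^sub>R 1 + (d *\<^sub>R 1 + st c * c)) * st c = st c * w"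
  proof -
    have "st c * e l = st c" by (simp add: c_def st_mult p mult.assoc)
    thus ?thesis by (simp add: w_def algebra_simps)
  qed
  also have "norm (st c * w) \<le> norm (st c) * d"
    by (meson mult_left_mono norm_ge_zero norm_mult_ineq order_trans w)
  finally have "(- l - 2 * d) * norm (st c) \<le> 0" by (simp add: algebra_simps)
  hence "norm (st c) \<le> 0" using neg d0 by (simp add: mult_le_0_iff)
  hence "c = 0" by (simp add: norm_st)
  hence "norm (l *\<^sub>R e l) \<le> d" using w by (simp add: w_def)
  thus False using neg d0 by (simp add: n1)
qed

text \<open>Eigenvalues of the approximants may be negative, but no lower than
  \<open>- 3 * d n\<close>; this excess over \<open>norm (s n)\<close> vanishes in the
  limit.\<close>

lemma norm_positive_mult_st: "norm_positive (b * st b)"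
proof -
  define y where "y = b * st b"
  have "st y = y" by (simp add: y_def st_mult st_st)
  then obtain L e where Le: "\<And>n. resolution (L n) (e n)" and lim: "(\<lambda>n. fcalc (L n) (e n) (\<lambda>x. x)) \<longlonglongrightarrow> y"
    by (rule resolution_sequence) blast
  define s where "s n = fcalc (L n) (e n) (\<lambda>x. x)" for n
  define d where "d n = norm (y - s n)" for n
  have s: "s \<longlonglongrightarrow> y" using lim by (simp add: s_def[abs_def])
  have "norm (norm (s n) *\<^sub>R 1 - s n) \<le> norm (s n) + 3 * d n" for n
  proof -
    have "norm (s n) *\<^sub>R 1 - s n = fcalc (L n) (e n) (\<lambda>x. norm (s n) - x)"
      unfolding fcalc_diff[OF Le, symmetric] fcalc_const[OF Le] by (simp add: s_def)
    moreover have "\<bar>norm (s n) - l\<bar> \<le> norm (s n) + 3 * d n" if l: "l \<in> L n" for l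
      using resolution_bound[OF Le l] eigenvalue_lower_bound[OF Le l, of "d n" b]
      by (auto simp: s_def d_def y_def abs_le_iff)
    moreover have "norm (s n) + 3 * d n \<ge> 0" by (simp add: d_def)
    ultimately show ?thesis using norm_fcalc_le[OF Le] by simp
  qed
  moreover have "(\<lambda>n. norm (norm (s n) *\<^sub>R 1 - s n)) \<longlonglongrightarrow> norm (norm y *\<^sub>R 1 - y)"
    by (intro tendsto_intros s)
  moreover have "(\<lambda>n. norm (s n) + 3 * d n) \<longlonglongrightarrow> norm y + 3 * norm (y - y)"
    unfolding d_def by (intro tendsto_intros s)
  ultimately have "norm (norm y *\<^sub>R 1 - y) \<le> norm y + 3 * norm (y - y)"
    by (intro LIMSEQ_le) auto
  thus ?thesis unfolding norm_positive_def y_def by auto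
qed

text \<open>With \<open>h = a a\<^sup>*\<close>, \<open>k = (1 - a)(1 - a)\<^sup>*\<close> and \<open>e\<close> the positive spectral projection of some \<open>s\<close>
  close to \<open>h - k\<close>, the element \<open>W = h e + k (1 - e)\<close> is close to \<open>(h + k + \<bar>s\<bar>) / 2\<close>, which is
  bounded below; the required idempotent is \<open>W e W\<inverse>\<close>.\<close>

lemma exchange_rr0: "exchange TYPE('a)"
  unfolding exchange_def
proof
  fix a :: 'a
  define h where "h = a * st a"
  define k where "k = (1 - a) * st (1 - a)"
  \<comment> \<open>Chosen for \<open>2 (h + k) = 1 + b * st b\<close>, which bounds
    \<open>h + k\<close> below by 1/2.\<close>
  define b where "b = a + a - 1"
  have "st (h - k) = h - k" by (simp add: h_def k_def st_diff st_mult st_st)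
  then obtain L p where res: "resolution L p" and near: "norm (h - k - fcalc L p (\<lambda>x. x)) < 1/4"
    using resolution_near[of "h - k" "1/4"] by auto
  define s where "s = fcalc L p (\<lambda>x. x)"
  define e where "e = fcalc L p (\<lambda>x. if x > 0 then 1 else 0)"
  define g where "g = fcalc L p (\<lambda>x. if x > 0 then 1 else - 1)"
  define m where "m = fcalc L p (\<lambda>x. \<bar>x\<bar>)"
  have ee: "e * e = e"
    unfolding e_def fcalc_mult[OF res] by (rule arg_cong[of _ _ "fcalc L p"]) auto
  have ge: "g = e + e - 1"
  proof -
    have "g - e = e - 1"
      unfolding g_def e_def fcalc_diff[OF res]
      using fcalc_diff[OF res, of "\<lambda>x. if x > 0 then 1 else 0" "\<lambda>x. 1"] fcalc_const[OF res, of 1]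
      by (auto intro!: arg_cong[of _ _ "fcalc L p"])
    thus ?thesis by (simp add: algebra_simps)
  qed
  have sg: "s * g = m"
    unfolding s_def g_def m_def fcalc_mult[OF res] by (rule arg_cong[of _ _ "fcalc L p"]) auto
  have ng: "norm g \<le> 1" unfolding g_def by (rule norm_fcalc_le[OF res]) auto
  have pm: "norm_positive m"
  proof -
    have "norm s *\<^sub>R 1 - m = fcalc L p (\<lambda>x. norm s - \<bar>x\<bar>)"
      unfolding m_def fcalc_diff[OF res, symmetric] fcalc_const[OF res] by simp
    moreover have "\<bar>norm s - \<bar>l\<bar>\<bar> \<le> norm s" if "l \<in> L" for l
      using resolution_bound[OF res that] by (simp add: s_def abs_le_iff)
    ultimately have "norm (norm s *\<^sub>R 1 - m) \<le> norm s" using norm_fcalc_le[OF res] by simp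
    thus ?thesis unfolding norm_positive_def by blast
  qed
  have "norm_positive (b * st b + (m + m))"
    by (intro norm_positive_add norm_positive_mult_st pm)
  then obtain M where M: "norm (M *\<^sub>R 1 - (b * st b + (m + m))) \<le> M" by (auto simp: norm_positive_def)
  define W where "W = h * e + k * (1 - e)"
  define r where "r = (h - k - s) * g"
  have hk: "h + h + k + k = 1 + b * st b"
    by (simp add: h_def k_def b_def st_diff st_add algebra_simps)
  have "W + W + W + W = (h + h + k + k) + ((h - k) * g + (h - k) * g)"
    by (simp add: W_def ge algebra_simps)
  also have "(h - k) * g = m + r" by (simp add: r_def algebra_simps sg)
  \<comment> \<open>The summand \<open>1\<close> outweighs the error \<open>r + r\<close> of norm at
    most 1/2, and the rest is norm-positive; the tolerance 1/4 for \<open>s\<close> serves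
    this.\<close>
  finally have W4: "W + W + W + W = 1 + b * st b + ((m + r) + (m + r))"
    unfolding hk .
  have "norm r \<le> norm (h - k - s) * norm g" unfolding r_def by (rule norm_mult_ineq)
  also have "\<dots> \<le> 1/4 * 1" using near ng by (intro mult_mono) (auto simp: s_def)
  finally have r: "norm r \<le> 1/4" by simp
  have "norm ((M + 1) *\<^sub>R 1 - (W + W + W + W)) = norm ((M *\<^sub>R 1 - (b * st b + (m + m))) - (r + r))"
    unfolding W4 by (simp add: algebra_simps)
  also have "\<dots> \<le> norm (M *\<^sub>R 1 - (b * st b + (m + m))) + norm (r + r)" by (rule norm_triangle_ineq4)
  also have "\<dots> < M + 1" using M r norm_triangle_ineq[of r r] by simp
  finally obtain V where V: "(W + W + W + W) * V = 1" "V * (W + W + W + W) = 1"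
    using invertible_el_near_scaleR unfolding invertible_el_def by blast
  define U where "U = V + V + V + V"
  have U: "W * U = 1" "U * W = 1" using V by (simp_all add: U_def distrib_left distrib_right)
  have We: "W * e = h * e" "W * (1 - e) = k * (1 - e)"
    by (simp_all add: W_def algebra_simps ee)
  have "idem (W * e * U)"
    unfolding idem_def by (metis U(2) ee mult.assoc mult_1_left)
  moreover have "W * e * U = a * (st a * e * U)" by (simp add: We h_def mult.assoc)
  moreover have "1 - W * e * U = (1 - a) * (st (1 - a) * (1 - e) * U)"
  proof -
    have "1 - W * e * U = W * (1 - e) * U" using U by (simp add: algebra_simps)
    thus ?thesis by (simp only: We k_def mult.assoc)
  qed
  ultimately show "\<exists>e u v. idem e \<and> e = a * u \<and> 1 - e = (1 - a) * v" by blast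
qed

end

section \<open>Maximal ideals and characters\<close>

definition two_sided_ideal :: "'a::ring_1 set \<Rightarrow> bool" where
  "two_sided_ideal M \<longleftrightarrow> 0 \<in> M \<and> (\<forall>x\<in>M. \<forall>y\<in>M. x + y \<in> M) \<and> (\<forall>x\<in>M. \<forall>a b. a * x * b \<in> M)"

lemma two_sided_ideal_gen: "two_sided_ideal (ideal_gen S)"
  by (simp add: two_sided_ideal_def ideal_gen.zero ideal_gen_add ideal_gen_mult)

lemma maximal_ideal_exists:
  fixes I :: "'a::ring_1 set"
  assumes "two_sided_ideal I" "1 \<notin> I"
  obtains M where "two_sided_ideal M" "1 \<notin> M" "I \<subseteq> M"
    "\<forall>N. two_sided_ideal N \<longrightarrow> 1 \<notin> N \<longrightarrow> M \<subseteq> N \<longrightarrow> N = M"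
proof -
  define A where "A = {M. two_sided_ideal M \<and> 1 \<notin> M \<and> I \<subseteq> M}"
  have "\<exists>M\<in>A. \<forall>X\<in>A. M \<subseteq> X \<longrightarrow> X = M"
  proof (rule subset_Zorn_nonempty)
    show "A \<noteq> {}" using assms by (auto simp: A_def)
    fix C assume C: "C \<noteq> {}" "subset.chain A C"
    have sub: "C \<subseteq> A" and tot: "\<And>X Y. X \<in> C \<Longrightarrow> Y \<in> C \<Longrightarrow> X \<subseteq> Y \<or> Y \<subseteq> X"
      using C(2) by (auto simp: subset_chain_def)
    have "x + y \<in> \<Union>C" if xy: "x \<in> \<Union>C" "y \<in> \<Union>C" for x y
    proof -
      obtain X Y where "X \<in> C" "x \<in> X" "Y \<in> C" "y \<in> Y" using xy by blast
      then obtain Z where "Z \<in> C" "x \<in> Z" "y \<in> Z" using tot by blast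
      thus ?thesis using sub unfolding A_def two_sided_ideal_def by blast
    qed
    moreover have "0 \<in> \<Union>C" "I \<subseteq> \<Union>C" "1 \<notin> \<Union>C"
      using C(1) sub by (auto simp: A_def two_sided_ideal_def)
    moreover have "a * x * b \<in> \<Union>C" if x: "x \<in> \<Union>C" for x a b
    proof -
      obtain X where X: "X \<in> C" "x \<in> X" using x by blast
      hence "a * x * b \<in> X" using sub by (auto simp: A_def two_sided_ideal_def)
      thus ?thesis using X(1) by blast
    qed
    ultimately show "\<Union>C \<in> A" unfolding A_def two_sided_ideal_def by simp
  qed
  then obtain M where M: "M \<in> A" "\<And>X. X \<in> A \<Longrightarrow> M \<subseteq> X \<Longrightarrow> X = M" by blast
  show ?thesis
    by (rule that[of M]) (use M in \<open>auto simp: A_def\<close>)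
qed

text \<open>No quotient is formed: one computes modulo a maximal ideal \<open>M\<close>, which is
  closed, prime and contains all commutators. Each approximant is congruent to one of its
  eigenvalues; \<open>bound\<close> makes these a Cauchy sequence and the scalar unique, hence
  additive and multiplicative in the element.\<close>

lemma (in cstar_rr0) full_ideal_if_no_character:
  assumes nc: "\<not> (\<exists>h. character sc h)"
  shows "1 \<in> ideal_gen {g * h * (1 - g) | g h :: 'a. idem g}"
proof (rule ccontr)
  let ?G = "{g * h * (1 - g) | g h :: 'a. idem g}"
  assume "1 \<notin> ideal_gen ?G"
  then obtain M where M: "two_sided_ideal M" "1 \<notin> M" "ideal_gen ?G \<subseteq> M"
    and maxi: "\<forall>N. two_sided_ideal N \<longrightarrow> 1 \<notin> N \<longrightarrow> M \<subseteq> N \<longrightarrow> N = M"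
    by (rule maximal_ideal_exists[OF two_sided_ideal_gen])
  have M0: "0 \<in> M" and Madd: "\<And>x y. x \<in> M \<Longrightarrow> y \<in> M \<Longrightarrow> x + y \<in> M"
    and Mmult: "\<And>x a b. x \<in> M \<Longrightarrow> a * x * b \<in> M"
    using M(1) by (auto simp: two_sided_ideal_def)
  have Ml: "a * x \<in> M" and Mr: "x * a \<in> M" if "x \<in> M" for x a
    using Mmult[OF that, of a 1] Mmult[OF that, of 1 a] by simp_all
  have Msc: "sc z x \<in> M" if "x \<in> M" for z x
    using Ml[OF that, of "sc z 1"] by (simp add: sc_mult_left)
  have Mscale: "r *\<^sub>R x \<in> M" if "x \<in> M" for r x
    using Msc[OF that, of "of_real r"] by (simp add: sc_of_real)
  have Mdiff: "x - y \<in> M" if "x \<in> M" "y \<in> M" for x y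
    using Madd[OF that(1) Mscale[OF that(2), of "-1"]] by simp
  have Msum: "(\<Sum>i\<in>I. f i) \<in> M" if "\<And>i. i \<in> I \<Longrightarrow> f i \<in> M" for I :: "real set" and f
    using that by (induction I rule: infinite_finite_induct) (auto intro: M0 Madd)
  have far: "norm (1 - x) \<ge> 1" if "x \<in> M" for x
  proof (rule ccontr)
    assume "\<not> norm (1 - x) \<ge> 1"
    then obtain d where "x * d = 1" using invertible_el_near_one[of x] by (auto simp: invertible_el_def)
    thus False using Mr[OF that, of d] M(2) by simp
  qed
  \<comment> \<open>By \<open>far\<close> the closure stays at distance at least 1 from
    \<open>1\<close>, so it is a proper ideal and maximality applies.\<close>
  have "closure M = M"
  proof (rule maxi[rule_format])
    show "two_sided_ideal (closure M)"
      unfolding two_sided_ideal_def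
    proof (intro conjI ballI allI)
      show "0 \<in> closure M" using M0 closure_subset by blast
      fix x assume "x \<in> closure M"
      then obtain X where X: "\<And>n. X n \<in> M" "X \<longlonglongrightarrow> x" unfolding closure_sequential by blast
      show "a * x * b \<in> closure M" for a b
        unfolding closure_sequential using X Mmult
        by (intro exI[of _ "\<lambda>n. a * X n * b"]) (auto intro!: tendsto_intros)
      fix y assume "y \<in> closure M"
      then obtain Y where Y: "\<And>n. Y n \<in> M" "Y \<longlonglongrightarrow> y" unfolding closure_sequential by blast
      show "x + y \<in> closure M"
        unfolding closure_sequential using X Y Madd
        by (intro exI[of _ "\<lambda>n. X n + Y n"]) (auto intro!: tendsto_intros)
    qed
    show "1 \<notin> closure M"
    proof
      assume "1 \<in> closure M"
      then obtain x where "x \<in> M" "dist x 1 < 1"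
        unfolding closure_approachable by (meson zero_less_one)
      thus False using far[of x] by (simp add: dist_norm norm_minus_commute)
    qed
  qed (rule closure_subset)
  hence cl: "closed M" by (metis closed_closure)
  have Mlim: "x \<in> M" if "\<And>n. X n \<in> M" "X \<longlonglongrightarrow> x" for X x
    using closed_sequentially[OF cl that] .
  have ce: "g * x - x * g \<in> M" if g: "g * g = g" for g x
  proof -
    have "idem g" "idem (1 - g)" using g by (simp_all add: idem_def algebra_simps)
    hence "g * x * (1 - g) \<in> ?G" "(1 - g) * x * (1 - (1 - g)) \<in> ?G" by blast+
    hence "g * x * (1 - g) \<in> M" "(1 - g) * x * (1 - (1 - g)) \<in> M"
      by (auto intro!: subsetD[OF M(3)] ideal_gen_base simp del: mem_Collect_eq)
    hence "g * x * (1 - g) - (1 - g) * x * (1 - (1 - g)) \<in> M" by (rule Mdiff)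
    thus ?thesis by (simp add: algebra_simps)
  qed
  have cs: "a * x - x * a \<in> M" if a: "st a = a" for a x
  proof -
    obtain L e where Le: "\<And>n. resolution (L n) (e n)" and lim: "(\<lambda>n. fcalc (L n) (e n) (\<lambda>x. x)) \<longlonglongrightarrow> a"
      using resolution_sequence[OF a] by blast
    have "fcalc (L n) (e n) (\<lambda>x. x) * x - x * fcalc (L n) (e n) (\<lambda>x. x) \<in> M" for n
    proof -
      have "fcalc (L n) (e n) (\<lambda>x. x) * x - x * fcalc (L n) (e n) (\<lambda>x. x) =
          (\<Sum>l\<in>L n. l *\<^sub>R (e n l * x - x * e n l))"
        by (simp add: fcalc_def sum_distrib_left sum_distrib_right sum_subtractf scaleR_diff_right)
      moreover have "l *\<^sub>R (e n l * x - x * e n l) \<in> M" if "l \<in> L n" for l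
        using Le[of n] that by (intro Mscale ce) (simp add: resolution_def)
      ultimately show ?thesis using Msum by simp
    qed
    moreover have "(\<lambda>n. fcalc (L n) (e n) (\<lambda>x. x) * x - x * fcalc (L n) (e n) (\<lambda>x. x)) \<longlonglongrightarrow> a * x - x * a"
      by (intro tendsto_intros lim)
    ultimately show ?thesis by (rule Mlim)
  qed
  have com: "a * x - x * a \<in> M" for a x
  proof -
    obtain R I where RI: "st R = R" "st I = I" "a = R + sc \<i> I" by (rule cartesian_decomposition)
    have "a * x - x * a = (R * x - x * R) + sc \<i> (I * x - x * I)"
      by (simp add: RI(3) algebra_simps sc_mult_left sc_mult_right sc_diff_right)
    thus ?thesis using RI cs Madd Msc by simp
  qed
  have prime: "y \<in> M" if xy: "x * y \<in> M" and x: "x \<notin> M" for x y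
  proof -
    \<comment> \<open>Because commutators lie in \<open>M\<close>, this right ideal is two-sided; it
      contains \<open>x\<close>, so by maximality it contains \<open>1\<close>.\<close>
    define N where "N = {m + x * r | m r. m \<in> M}"
    have MN: "M \<subseteq> N"
    proof
      fix m assume "m \<in> M"
      moreover have "m = m + x * 0" by simp
      ultimately show "m \<in> N" unfolding N_def by blast
    qed
    have "two_sided_ideal N"
      unfolding two_sided_ideal_def
    proof (intro conjI ballI allI)
      show "0 \<in> N" using M0 MN by blast
      fix u assume "u \<in> N"
      then obtain m r where u: "u = m + x * r" "m \<in> M" unfolding N_def by blast
      show "a * u * b \<in> N" for a b
      proof -
        have "a * u * b = (a * m * b + (a * x - x * a) * (r * b)) + x * (a * r * b)"
          by (simp add: u algebra_simps)
        moreover have "a * m * b + (a * x - x * a) * (r * b) \<in> M"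
          by (intro Madd Mmult Mr com u(2))
        ultimately show ?thesis unfolding N_def by blast
      qed
      fix v assume "v \<in> N"
      then obtain m' r' where v: "v = m' + x * r'" "m' \<in> M" unfolding N_def by blast
      have "u + v = (m + m') + x * (r + r')" by (simp add: u v algebra_simps)
      thus "u + v \<in> N" unfolding N_def using Madd[OF u(2) v(2)] by blast
    qed
    moreover have "x = 0 + x * 1" by simp
    hence "x \<in> N" unfolding N_def using M0 by blast
    ultimately have "1 \<in> N" using maxi MN x by blast
    then obtain m r where mr: "1 = m + x * r" "m \<in> M" unfolding N_def by blast
    have "y = (m + x * r) * y" by (simp flip: mr(1))
    also have "\<dots> = m * y + (x * y * r + x * (r * y - y * r))"
      by (simp add: algebra_simps)
    also have "\<dots> \<in> M" by (rule Madd[OF Mr[OF mr(2)] Madd[OF Mr[OF xy] Ml[OF com]]])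
    finally show ?thesis .
  qed
  have bound: "cmod z \<le> norm x" if "x - sc z 1 \<in> M" for x z
  proof (rule ccontr)
    assume "\<not> cmod z \<le> norm x"
    hence z: "norm x < cmod z" by simp
    hence z0: "z \<noteq> 0" by auto
    have "sc (- 1 / z) (x - sc z 1) \<in> M" using that by (rule Msc)
    moreover have "1 - sc (- 1 / z) (x - sc z 1) = sc (1 / z) x"
      using z0 by (simp add: sc_diff_right sc_sc sc_minus_left)
    ultimately have "1 \<le> norm x / cmod z"
      using far[of "sc (- 1 / z) (x - sc z 1)"] by (simp add: norm_sc norm_divide)
    thus False using z z0 by simp
  qed
  have val: "\<exists>l. a - sc (of_real l) 1 \<in> M" if a: "st a = a" for a
  proof -
    obtain L e where Le: "\<And>n. resolution (L n) (e n)" and lim: "(\<lambda>n. fcalc (L n) (e n) (\<lambda>x. x)) \<longlonglongrightarrow> a"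
      using resolution_sequence[OF a] by blast
    define s where "s n = fcalc (L n) (e n) (\<lambda>x. x)" for n
    have s: "s \<longlonglongrightarrow> a" using lim by (simp add: s_def[abs_def])
    have "\<exists>l. s n - sc (of_real l) 1 \<in> M" for n
    proof -
      have "(\<Sum>l\<in>L n. e n l) \<notin> M" using Le[of n] M(2) by (simp add: resolution_def)
      \<comment> \<open>The projections sum to \<open>1\<close>, so one of them escapes
        \<open>M\<close>; primeness then removes it from the eigenvalue equation.\<close>
      then obtain l where l: "l \<in> L n" "e n l \<notin> M" using Msum by blast
      have z: "(s n - sc (of_real l) 1) * e n l = 0"
        unfolding s_def left_diff_distrib fcalc_eigen[OF Le l(1)] sc_mult_left
        by (simp add: sc_of_real)
      have "e n l * (s n - sc (of_real l) 1) =
          (e n l * (s n - sc (of_real l) 1) - (s n - sc (of_real l) 1) * e n l)" by (simp add: z)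
      also have "\<dots> \<in> M" by (rule com)
      finally show ?thesis using prime l(2) by blast
    qed
    then obtain l where l: "\<And>n. s n - sc (of_real (l n)) 1 \<in> M" by metis
    have "dist (l m) (l n) \<le> dist (s m) (s n)" for m n
    proof -
      have "(s m - s n) - sc (of_real (l m - l n)) 1 =
          (s m - sc (of_real (l m)) 1) - (s n - sc (of_real (l n)) 1)"
        by (simp add: sc_diff_left)
      also have "\<dots> \<in> M" by (rule Mdiff[OF l l])
      finally have "cmod (of_real (l m - l n)) \<le> norm (s m - s n)" by (rule bound)
      thus ?thesis by (simp only: dist_norm norm_of_real real_norm_def)
    qed
    moreover have "Cauchy s" using s by (simp add: LIMSEQ_imp_Cauchy)
    ultimately have "Cauchy l" unfolding Cauchy_def by (meson le_less_trans)
    then obtain k where k: "l \<longlonglongrightarrow> k" using Cauchy_convergent convergent_def by blast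
    have "s n - l n *\<^sub>R 1 \<in> M" for n using l[of n] by (simp add: sc_of_real)
    moreover have "(\<lambda>n. s n - l n *\<^sub>R 1) \<longlonglongrightarrow> a - k *\<^sub>R 1" by (intro tendsto_intros s k)
    ultimately have "a - k *\<^sub>R 1 \<in> M" by (rule Mlim)
    hence "a - sc (of_real k) 1 \<in> M" by (simp add: sc_of_real)
    thus ?thesis by blast
  qed
  have "\<exists>z. a - sc z 1 \<in> M" for a
  proof -
    obtain R I where RI: "st R = R" "st I = I" "a = R + sc \<i> I" by (rule cartesian_decomposition)
    obtain k l where kl: "R - sc (of_real k) 1 \<in> M" "I - sc (of_real l) 1 \<in> M" using RI val by metis
    have "a - sc (of_real k + \<i> * of_real l) 1 = (R - sc (of_real k) 1) + sc \<i> (I - sc (of_real l) 1)"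
      by (simp add: RI(3) sc_add_left sc_diff_right sc_sc)
    thus ?thesis using Madd[OF kl(1) Msc[OF kl(2)]] by metis
  qed
  then obtain h where h: "\<And>a. a - sc (h a) 1 \<in> M" by metis
  have uniq: "h a = z" if "a - sc z 1 \<in> M" for a z
  proof -
    have "0 - sc (h a - z) 1 = (a - sc (h a) 1) - (a - sc z 1)" by (simp add: sc_diff_left)
    also have "\<dots> \<in> M" by (rule Mdiff[OF h that])
    finally have "cmod (h a - z) \<le> norm (0::'a)" by (rule bound)
    thus ?thesis by simp
  qed
  have "character sc h"
    unfolding character_def
  proof (intro conjI allI)
    fix a b c
    have "(a + b) - sc (h a + h b) 1 = (a - sc (h a) 1) + (b - sc (h b) 1)"
      by (simp add: sc_add_left)
    also have "\<dots> \<in> M" by (intro Madd h)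
    finally show "h (a + b) = h a + h b" by (rule uniq)
    have "sc c a - sc (c * h a) 1 = sc c (a - sc (h a) 1)" by (simp add: sc_diff_right sc_sc)
    also have "\<dots> \<in> M" by (intro Msc h)
    finally show "h (sc c a) = c * h a" by (rule uniq)
    have "a * b - sc (h a * h b) 1 = (a - sc (h a) 1) * b + sc (h a) (b - sc (h b) 1)"
      by (simp add: left_diff_distrib sc_mult_left sc_diff_right sc_sc)
    also have "\<dots> \<in> M" by (intro Madd Mr Msc h)
    finally show "h (a * b) = h a * h b" by (rule uniq)
  next
    have "1 - sc 1 1 \<in> M" using M0 by simp
    hence "h 1 = 1" by (rule uniq)
    thus "\<exists>a. h a \<noteq> 0" by (intro exI[of _ 1]) simp
  qed
  thus False using nc by blast
qed

theorem theorem6p3: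
  fixes sc :: "complex \<Rightarrow> 'a::{banach,real_normed_algebra_1} \<Rightarrow> 'a"
    and st :: "'a \<Rightarrow> 'a"
  assumes "cstar_algebra sc st"
    and "real_rank_zero sc st"
    and "\<not> (\<exists>h. character sc h)"
  shows "xi_le 3 TYPE('a) \<and>
         (UNIV :: 'a set) = set_sum commutators (set_prod commutators commutators)"
proof -
  interpret cstar_rr0 sc st using assms(1,2) by unfold_locales
  show ?thesis
    using exchange_commutator_products exchange_rr0 full_ideal_if_no_character assms(3) by blast
qed

end
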